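(* There is an absolute constant $C>0$ such that for all $r,s\in[2,\infty]$, all positive integers $m,n$ and every matrix $A=(a_{ij})_{i\le m,\,j\le n}$ with nonnegative entries, $$\gamma_2(K,d)\le C\,(R+P),\qquad P=\gamma_{2,2}(K,\rho),\quad R=\sup_{z\in K}\|T_z\|_{\mathrm{HS}},$$ where $K$, $d$, $\rho$, $T_z$ are the objects defined from $A,r,s$ in the context.
   Context: Set $K=B_{2,+}^m\times B_{2,+}^n$, where $B_{2,+}^d=\{x\in\mathbb R^d: x_i\ge0\ \forall i,\ \|x\|_2\le1\}$. Put $\alpha=2-2/s$, $\beta=2-2/r$ (with $2/\infty=0$), so $\alpha,\beta\in[1,2]$. Use the convention $t^0=1$ for all $t\ge0$, including $t=0$. For $z=(u,v)\in K$ define $F(z)\in\mathbb R^{m\times n}$ by $F(u,v)_{ij}=a_{ij}u_i^\alpha v_j^\beta$, and $$U_{ij}(z)=\alpha a_{ij}u_i^{\alpha-1}v_j^\beta,\qquad V_{ij}(z)=\beta a_{ij}u_i^\alpha v_j^{\beta-1}.$$ The linear map $T_z:\mathbb R^{m}\times\mathbb R^n\to\mathbb R^{m\times n}$ is $(T_z(h,k))_{ij}=U_{ij}(z)h_i+V_{ij}(z)k_j$, and $\|T_z\|_{\mathrm{HS}}$ is its Hilbert–Schmidt norm with respect to the Euclidean structures. The pseudometrics on $K$ are $$d(z,z')=\|F(z)-F(z')\|_2\quad\text{(Frobenius norm)},$$ $$\rho(z,z')=\max_{i\le m}\|(U_{ij}(z)-U_{ij}(z'))_{j\le n}\|_2+\max_{j\le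 n}\|(V_{ij}(z)-V_{ij}(z'))_{i\le m}\|_2.$$ Chaining functionals: for a pseudometric space $(T,\delta)$, an admissible sequence is a sequence of nested partitions $(\mathcal A_k)_{k\ge0}$ of $T$ (each $\mathcal A_{k+1}$ refines $\mathcal A_k$) with $\mathcal A_0=\{T\}$ and $|\mathcal A_k|\le2^{2^k}$; $\mathcal A_k(x)$ is the cell of $\mathcal A_k$ containing $x$. Then $$\gamma_{2}(T,\delta)=\inf_{(\mathcal A_k)}\sup_{x\in T}\sum_{k\ge0}2^{k/2}\operatorname{diam}_\delta(\mathcal A_k(x)),\qquad \gamma_{2,2}(T,\delta)=\inf_{(\mathcal A_k)}\sup_{x\in T}\Big(\sum_{k\ge0}2^{k}\operatorname{diam}_\delta(\mathcal A_k(x))^2\Big)^{1/2}.$$ *)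

theory Defs
  imports "HOL-Analysis.Analysis" "HOL-Library.Disjoint_Sets"
begin

text \<open>
  The pseudometric is passed as a bare real-valued function. Diameters and the
  chaining functionals take values in \<open>[0, \<infinity>]\<close>, so that no finiteness is presupposed.
\<close>

definition pdiam :: "('a \<Rightarrow> 'a \<Rightarrow> real) \<Rightarrow> 'a set \<Rightarrow> ennreal" where
  "pdiam \<delta> S = (SUP x\<in>S. SUP y\<in>S. ennreal (\<delta> x y))"

definition admissible :: "'a set \<Rightarrow> (nat \<Rightarrow> 'a set set) \<Rightarrow> bool" where
  "admissible T \<A> \<longleftrightarrow>
     (\<forall>k. partition_on T (\<A> k)) \<and>
     (\<forall>k. refines T (\<A> (Suc k)) (\<A> k)) \<and>
     \<A> 0 = {T} \<and>
     (\<forall>k. finite (\<A> k) \<and> card (\<A> k) \<le> 2 ^ (2 ^ k))"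

definition cell :: "'a set set \<Rightarrow> 'a \<Rightarrow> 'a set" where
  "cell \<P> x = (THE S. S \<in> \<P> \<and> x \<in> S)"

definition ennreal_sqrt :: "ennreal \<Rightarrow> ennreal" where
  "ennreal_sqrt x = (if x = \<infinity> then \<infinity> else ennreal (sqrt (enn2real x)))"

definition gamma2 :: "'a set \<Rightarrow> ('a \<Rightarrow> 'a \<Rightarrow> real) \<Rightarrow> ennreal" where
  "gamma2 T \<delta> =
     (INF \<A>\<in>{\<A>. admissible T \<A>}. SUP x\<in>T.
        (\<Sum>k. ennreal (2 powr (real k / 2)) * pdiam \<delta> (cell (\<A> k) x)))"

definition gamma22 :: "'a set \<Rightarrow> ('a \<Rightarrow> 'a \<Rightarrow> real) \<Rightarrow> ennreal" where
  "gamma22 T \<delta> =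
     (INF \<A>\<in>{\<A>. admissible T \<A>}. SUP x\<in>T.
        ennreal_sqrt (\<Sum>k. 2 ^ k * (pdiam \<delta> (cell (\<A> k) x))\<^sup>2))"

text \<open>
  The dimensions \<open>m\<close>, \<open>n\<close> are quantified inside the theorem, so vectors and matrices are
  functions on natural numbers, with the index \<open>i\<close> ranging over \<open>{..<m}\<close> and \<open>j\<close> over
  \<open>{..<n}\<close>. Elements of \<open>K\<close> vanish outside the index range, so each point of the Euclidean
  space has exactly one representative. Entries of matrices outside the index range are never
  inspected.
\<close>

type_synonym rvec = "nat \<Rightarrow> real"
type_synonym rmat = "nat \<Rightarrow> nat \<Rightarrow> real"

definition pos_ball :: "nat \<Rightarrow> rvec set" where
  "pos_ball d = {x. (\<forall>i<d. 0 \<le> x i) \<and> (\<forall>i\<ge>d. x i = 0) \<and> L2_set x {..<d} \<le> 1}"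

definition K_set :: "nat \<Rightarrow> nat \<Rightarrow> (rvec \<times> rvec) set" where
  "K_set m n = pos_ball m \<times> pos_ball n"

definition frob_norm :: "nat \<Rightarrow> nat \<Rightarrow> rmat \<Rightarrow> real" where
  "frob_norm m n M = L2_set (\<lambda>(i, j). M i j) ({..<m} \<times> {..<n})"

definition unit_vec :: "nat \<Rightarrow> rvec" where
  "unit_vec i = (\<lambda>l. if l = i then 1 else 0)"

text \<open>
  Hilbert--Schmidt norm of a linear map from the product of the Euclidean spaces of dimensions
  \<open>m\<close> and \<open>n\<close> to the \<open>m \<times> n\<close> matrices: the square root of the sum of the squared norms of the
  images of the standard orthonormal basis \<open>(e\<^sub>i, 0)\<close>, \<open>(0, e\<^sub>j)\<close>.
\<close>

definition hs_norm :: "nat \<Rightarrow> nat \<Rightarrow> (rvec \<times> rvec \<Rightarrow> rmat) \<Rightarrow> real" where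
  "hs_norm m n L =
     sqrt ((\<Sum>i<m. (frob_norm m n (L (unit_vec i, (\<lambda>_. 0))))\<^sup>2) +
           (\<Sum>j<n. (frob_norm m n (L ((\<lambda>_. 0), unit_vec j)))\<^sup>2))"

text \<open>For \<open>p \<in> [2, \<infinity>]\<close>; extended real division gives \<open>2 / \<infinity> = 0\<close>.\<close>

definition expo :: "ereal \<Rightarrow> real" where
  "expo p = real_of_ereal (2 - 2 / p)"

text \<open>Powers with \<open>t\<^sup>0 = 1\<close> also at \<open>t = 0\<close>, whereas \<open>0 powr 0 = 0\<close>.\<close>

definition rpow :: "real \<Rightarrow> real \<Rightarrow> real" where
  "rpow t a = (if a = 0 then 1 else t powr a)"

definition F_map :: "real \<Rightarrow> real \<Rightarrow> rmat \<Rightarrow> rvec \<times> rvec \<Rightarrow> rmat" where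
  "F_map \<alpha> \<beta> a = (\<lambda>(u, v) i j. a i j * rpow (u i) \<alpha> * rpow (v j) \<beta>)"

definition U_map :: "real \<Rightarrow> real \<Rightarrow> rmat \<Rightarrow> rvec \<times> rvec \<Rightarrow> rmat" where
  "U_map \<alpha> \<beta> a = (\<lambda>(u, v) i j. \<alpha> * a i j * rpow (u i) (\<alpha> - 1) * rpow (v j) \<beta>)"

definition V_map :: "real \<Rightarrow> real \<Rightarrow> rmat \<Rightarrow> rvec \<times> rvec \<Rightarrow> rmat" where
  "V_map \<alpha> \<beta> a = (\<lambda>(u, v) i j. \<beta> * a i j * rpow (u i) \<alpha> * rpow (v j) (\<beta> - 1))"

definition T_map :: "real \<Rightarrow> real \<Rightarrow> rmat \<Rightarrow> rvec \<times> rvec \<Rightarrow> rvec \<times> rvec \<Rightarrow> rmat" where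
  "T_map \<alpha> \<beta> a z = (\<lambda>(h, k) i j. U_map \<alpha> \<beta> a z i j * h i + V_map \<alpha> \<beta> a z i j * k j)"

definition d_dist ::
  "nat \<Rightarrow> nat \<Rightarrow> real \<Rightarrow> real \<Rightarrow> rmat \<Rightarrow> rvec \<times> rvec \<Rightarrow> rvec \<times> rvec \<Rightarrow> real" where
  "d_dist m n \<alpha> \<beta> a z z' =
     frob_norm m n (\<lambda>i j. F_map \<alpha> \<beta> a z i j - F_map \<alpha> \<beta> a z' i j)"

definition rho_dist ::
  "nat \<Rightarrow> nat \<Rightarrow> real \<Rightarrow> real \<Rightarrow> rmat \<Rightarrow> rvec \<times> rvec \<Rightarrow> rvec \<times> rvec \<Rightarrow> real" where
  "rho_dist m n \<alpha> \<beta> a z z' =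
     (MAX i\<in>{..<m}. L2_set (\<lambda>j. U_map \<alpha> \<beta> a z i j - U_map \<alpha> \<beta> a z' i j) {..<n}) +
     (MAX j\<in>{..<n}. L2_set (\<lambda>i. V_map \<alpha> \<beta> a z i j - V_map \<alpha> \<beta> a z' i j) {..<m})"

end

theory Submission
  imports Defs
begin

text \<open>
  Since \<open>F\<close> and its partial derivatives are increasing, increments of \<open>F\<close> are controlled entrywise by
  the two endpoints alone, with no detour along a segment:
  \<open>|F(z)\<^sub>i\<^sub>j - F(z')\<^sub>i\<^sub>j|\<close> is at most the larger of \<open>U(z)\<^sub>i\<^sub>j\<close>, \<open>U(z')\<^sub>i\<^sub>j\<close> times
  \<open>|u\<^sub>i - u'\<^sub>i|\<close> plus the analogous term with \<open>V\<close> and \<open>v\<close>. Let \<open>w(z)\<close> be the vector that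
  collects the row norms of \<open>U(z)\<close> and the column norms of \<open>V(z)\<close>. Then
  \<open>d(z,z') \<le> 2 \<parallel>w(z) (z - z')\<parallel> + \<rho>(z,z') \<parallel>z - z'\<parallel>\<close> with a coordinatewise product (lemma \<open>d_le\<close>),
  the Euclidean norm of \<open>w(z)\<close> is the Hilbert--Schmidt norm of \<open>T\<^sub>z\<close>, and \<open>w\<close> is Lipschitz from \<open>\<rho>\<close>
  to the supremum norm. Locally, \<open>d\<close> is therefore the norm of a diagonal ellipsoid.
  
  Let \<open>M\<close> be of order \<open>R + P\<close>. The entropy numbers \<open>e\<^sub>k(w)\<close> of such ellipsoids satisfy
  \<open>\<Sum> 2\<^sup>k e\<^sub>k(w)\<^sup>2 \<le> 4 \<parallel>w\<parallel>\<^sup>2\<close> (lemmas \<open>splits_ellipsoid\<close>, \<open>sum_ell_num\<close>). Adding to \<open>e\<^sub>k(w(z))\<close> the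
  \<open>\<rho>\<close>-distance of \<open>z\<close> to the net of level \<open>k\<close> given by \<open>\<gamma>\<^sub>2\<^sub>,\<^sub>2\<close> produces functions
  \<open>\<phi>\<^sub>k\<close> with \<open>\<Sum> 2\<^sup>k \<phi>\<^sub>k(z)\<^sup>2 \<le> M\<^sup>2\<close> for every \<open>z\<close>, and a set of Euclidean diameter \<open>X\<close> on which
  \<open>\<phi>\<^sub>k \<le> \<theta>\<close> splits into doubly exponentially many pieces of \<open>d\<close>-diameter of order \<open>\<theta> X\<close>. With \<open>X\<close> of
  order one this would require \<open>\<Sum> 2\<^sup>k\<^sup>/\<^sup>2 \<phi>\<^sub>k\<close> to be finite; as only the squares are summable, the
  Euclidean diameters that are used have to be square summable as well.
  
  Interpolation achieves this. At level \<open>k\<close> the point \<open>z\<close> is replaced by a near minimiser \<open>y\<^sub>k(z)\<close> of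
  \<open>M \<parallel>y\<parallel>\<^sup>2 + M\<^sup>-\<^sup>1 \<Sum>\<^sub>j\<^sub>\<le>\<^sub>k 2\<^sup>j \<phi>\<^sub>j(y)\<^sup>2 + 2\<^sup>k\<^sup>/\<^sup>2 d(z,y)\<close>. The minima are bounded by \<open>3 M\<close> and increase with
  \<open>k\<close>, and comparing consecutive ones yields \<open>\<Sum> 2\<^sup>k\<^sup>/\<^sup>2 d(z,y\<^sub>k(z)) \<le> 20 M\<close> and
  \<open>\<Sum> 2\<^sup>k \<phi>\<^sub>k(y\<^sub>k(z))\<^sup>2 \<le> 5 M\<^sup>2\<close> (lemma \<open>sum_near\<close>); in particular \<open>\<phi>\<^sub>k\<close> stays under control along the
  moving points, although nothing relates \<open>\<phi>\<^sub>k(y\<^sub>k(z))\<close> to \<open>\<phi>\<^sub>k(z)\<close> directly. Convexity enters through the coordinatewise geometric mean \<open>m\<close> of two points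
  \<open>y\<close>, \<open>y'\<close>: entries of \<open>F\<close>, \<open>U\<close>, \<open>V\<close> are monomials, so their values at \<open>m\<close> lie between those
  at \<open>y\<close> and \<open>y'\<close>, while \<open>\<parallel>m\<parallel>\<^sup>2\<close> is smaller than the average of \<open>\<parallel>y\<parallel>\<^sup>2\<close>, \<open>\<parallel>y'\<parallel>\<^sup>2\<close> by
  \<open>\<parallel>y - y'\<parallel>\<^sup>2 / 2\<close>. Testing near minimality against \<open>m\<close> bounds \<open>\<parallel>y\<^sub>k(z) - y\<^sub>k(z')\<parallel>\<^sup>2\<close> by a multiple of
  \<open>2\<^sup>k\<^sup>/\<^sup>2 d(y\<^sub>k(z),y\<^sub>k(z')) / M + 2\<^sup>k \<theta>\<^sup>2 / M\<^sup>2 + 2\<^sup>-\<^sup>k\<close> (lemma \<open>near_close\<close>).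
  
  Hence in a set of \<open>d\<close>-diameter \<open>\<delta>\<close> the pieces of level \<open>k\<close> have diameter at most a small
  multiple of \<open>\<delta>\<close> plus an error \<open>t\<^sub>k(z)\<close> with \<open>\<Sum> 2\<^sup>k\<^sup>/\<^sup>2 t\<^sub>k(z)\<close> of order \<open>M\<close> (lemma \<open>splits_step\<close>): the
  arithmetic--geometric mean inequality separates \<open>\<delta>\<close> from \<open>2\<^sup>k\<^sup>/\<^sup>2 \<theta>\<^sup>2 / M\<close>. Iterating the splitting is a
  contraction for the weighted diameters, and the partitions so obtained, delayed by a constant number
  of levels to meet the cardinality bound, prove the estimate.
\<close>

section \<open>Colourings\<close>

text \<open>
  A colouring of \<open>B\<close> with at most \<open>N\<close> colours such that points of equal colour are related by \<open>R\<close>.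
  Colourings are used in place of partitions because successive refinements just pair the colours,
  and because no care is needed about empty classes.
\<close>

definition splits :: "'a set \<Rightarrow> nat \<Rightarrow> ('a \<Rightarrow> 'a \<Rightarrow> bool) \<Rightarrow> bool" where
  "splits B N R \<longleftrightarrow> (\<exists>l::'a \<Rightarrow> nat. (\<forall>x\<in>B. l x < N) \<and> (\<forall>x\<in>B. \<forall>y\<in>B. l x = l y \<longrightarrow> R x y))"

lemma splits_mono:
  assumes "splits B N R" "N \<le> N'" "\<And>x y. x \<in> B \<Longrightarrow> y \<in> B \<Longrightarrow> R x y \<Longrightarrow> R' x y"
  shows "splits B N' R'"
proof -
  obtain l :: "'a \<Rightarrow> nat" where l: "\<forall>x\<in>B. l x < N" "\<forall>x\<in>B. \<forall>y\<in>B. l x = l y \<longrightarrow> R x y"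
    using assms(1) unfolding splits_def by auto
  then show ?thesis unfolding splits_def
    by (intro exI[of _ l]) (use assms(2,3) in force)
qed

lemma splits_vimage:
  fixes f :: "'a \<Rightarrow> 'b"
  assumes "splits (f ` B) N R"
  shows "splits B N (\<lambda>x y. R (f x) (f y))"
proof -
  obtain l :: "'b \<Rightarrow> nat" where "\<forall>x\<in>f ` B. l x < N"
    and "\<forall>x\<in>f ` B. \<forall>y\<in>f ` B. l x = l y \<longrightarrow> R x y"
    using assms unfolding splits_def by auto
  then show ?thesis unfolding splits_def by (intro exI[of _ "l \<circ> f"]) auto
qed

lemma splits_trans:
  assumes "splits B N R"
    and refine: "\<And>B'. B' \<subseteq> B \<Longrightarrow> (\<And>x y. x \<in> B' \<Longrightarrow> y \<in> B' \<Longrightarrow> R x y) \<Longrightarrow> splits B' N' R'"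
  shows "splits B (N * N') R'"
proof -
  obtain l :: "'a \<Rightarrow> nat" where l: "\<forall>x\<in>B. l x < N" "\<forall>x\<in>B. \<forall>y\<in>B. l x = l y \<longrightarrow> R x y"
    using assms(1) unfolding splits_def by auto
  have "splits {x\<in>B. l x = i} N' R'" for i
    by (rule refine) (use l in auto)
  then obtain h :: "nat \<Rightarrow> 'a \<Rightarrow> nat" where h: "\<And>i x. x \<in> B \<Longrightarrow> l x = i \<Longrightarrow> h i x < N'"
    "\<And>i x y. x \<in> B \<Longrightarrow> y \<in> B \<Longrightarrow> l x = i \<Longrightarrow> l y = i \<Longrightarrow> h i x = h i y \<Longrightarrow> R' x y"
    unfolding splits_def by (simp) metis
  define c where "c x = l x * N' + h (l x) x" for x
  have "c x < N * N'" if "x \<in> B" for x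
  proof -
    have "c x < Suc (l x) * N'" using h(1)[OF that refl] by (simp add: c_def)
    also have "\<dots> \<le> N * N'" using l(1) that by (intro mult_right_mono) (auto simp: Suc_le_eq)
    finally show ?thesis .
  qed
  moreover have "R' x y" if "x \<in> B" "y \<in> B" "c x = c y" for x y
  proof -
    have hx: "h (l x) x < N'" "h (l y) y < N'" using h(1) that by auto
    have "l x = c x div N'" "l y = c y div N'" using hx by (auto simp: c_def)
    then have "l x = l y" using that by simp
    with that have "h (l x) x = h (l x) y" by (simp add: c_def)
    with h(2) that \<open>l x = l y\<close> show ?thesis by metis
  qed
  ultimately show ?thesis unfolding splits_def by blast
qed

lemma splits_by_code:
  assumes "finite V" "card V \<le> N" "\<And>x. x \<in> B \<Longrightarrow> c x \<in> V"
    and "\<And>x y. x \<in> B \<Longrightarrow> y \<in> B \<Longrightarrow> c x = c y \<Longrightarrow> R x y"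
  shows "splits B N R"
proof -
  obtain h where h: "bij_betw h V {0..<card V}" using ex_bij_betw_finite_nat[OF assms(1)] by blast
  have "h (c x) < N" if "x \<in> B" for x
  proof -
    have "h (c x) \<in> {0..<card V}" using h assms(3)[OF that] by (auto simp: bij_betw_def)
    then show ?thesis using assms(2) by auto
  qed
  moreover have "R x y" if "x \<in> B" "y \<in> B" "h (c x) = h (c y)" for x y
    using h assms(3,4) that by (metis bij_betw_def inj_onD)
  ultimately show ?thesis unfolding splits_def by (intro exI[of _ "h \<circ> c"]) auto
qed

lemma splits_real:
  assumes "\<And>x. x \<in> B \<Longrightarrow> 0 \<le> f x \<and> f x \<le> real N * \<mu>" "0 < \<mu>"
  shows "splits B (Suc N) (\<lambda>x y. \<bar>f x - f y\<bar> \<le> \<mu>)"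
proof (rule splits_by_code[where V = "{0..int N}" and c = "\<lambda>x. \<lfloor>f x / \<mu>\<rfloor>"])
  fix x assume "x \<in> B"
  then have "0 \<le> f x / \<mu>" "f x / \<mu> \<le> real_of_int (int N)"
    using assms by (auto simp: field_simps)
  then show "\<lfloor>f x / \<mu>\<rfloor> \<in> {0..int N}" by (simp add: floor_le_iff)
next
  fix x y assume "\<lfloor>f x / \<mu>\<rfloor> = \<lfloor>f y / \<mu>\<rfloor>"
  then have "\<bar>f x / \<mu> - f y / \<mu>\<bar> \<le> 1" by linarith
  then have "\<bar>f x - f y\<bar> / \<mu> \<le> 1" using assms(2) by (simp add: abs_divide flip: diff_divide_distrib)
  then show "\<bar>f x - f y\<bar> \<le> \<mu>" using assms(2) by (simp add: field_simps)
qed auto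

section \<open>From splittings to chaining\<close>

lemma two_powr_half: "2 powr (real k / 2) = sqrt 2 ^ k"
proof -
  have "sqrt 2 ^ k = sqrt 2 powr real k" by (simp add: powr_realpow)
  then show ?thesis by (simp add: powr_half_sqrt[symmetric] powr_powr)
qed

lemma gamma2_leI:
  assumes "admissible T \<A>"
    and "\<And>x n. x \<in> T \<Longrightarrow> (\<Sum>k<n. ennreal (2 powr (real k / 2)) * pdiam \<delta> (cell (\<A> k) x)) \<le> c"
  shows "gamma2 T \<delta> \<le> c"
  unfolding gamma2_def
proof (rule INF_lower2[of \<A>])
  show "(SUP x\<in>T. \<Sum>k. ennreal (2 powr (real k / 2)) * pdiam \<delta> (cell (\<A> k) x)) \<le> c"
    using assms(2) by (intro SUP_least suminf_le_const) auto
qed (use assms(1) in simp)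

lemma partition_on_classes:
  assumes "\<And>x. x \<in> T \<Longrightarrow> x \<in> f x \<and> f x \<subseteq> T" "\<And>x y. x \<in> T \<Longrightarrow> y \<in> f x \<Longrightarrow> f y = f x"
  shows "partition_on T (f ` T)" and "\<And>x. x \<in> T \<Longrightarrow> cell (f ` T) x = f x"
proof -
  show "partition_on T (f ` T)"
  proof (rule partition_onI)
    show "\<Union> (f ` T) = T" using assms(1) by blast
    fix p p' assume "p \<in> f ` T" "p' \<in> f ` T" "p \<noteq> p'"
    then obtain x y where xy: "x \<in> T" "y \<in> T" "p = f x" "p' = f y" "f x \<noteq> f y" by blast
    show "disjnt p p'"
      unfolding disjnt_iff xy(3,4) using assms(2)[OF xy(1)] assms(2)[OF xy(2)] xy(5) by metis
  qed (use assms(1) in auto)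
  fix x assume "x \<in> T"
  show "cell (f ` T) x = f x" unfolding cell_def
  proof (rule the_equality)
    fix S assume "S \<in> f ` T \<and> x \<in> S"
    then obtain y where "y \<in> T" "S = f y" "x \<in> f y" by blast
    then show "S = f x" using assms(2)[of y x] by simp
  qed (use assms(1) \<open>x \<in> T\<close> in blast)
qed

text \<open>
  Splitting repeatedly, level \<open>k\<close> after level \<open>k - 1\<close>, produces at most \<open>2\<close> to the power
  \<open>2\<^sup>\<tau> * 2\<^sup>k\<close> classes, so the partition of level \<open>k\<close> is used at level \<open>k + \<tau>\<close>. The diameter of a class
  shrinks by the factor \<open>4\<close> up to the error \<open>2 t\<^sub>k\<close>, whereas the weight \<open>2\<^sup>k\<^sup>/\<^sup>2\<close> only grows by
  \<open>\<surd>2 < 4\<close>; for this reason the weighted sum of the diameters is bounded by those of the errors and the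
  initial diameter, on every finite range of levels and hence altogether.
\<close>

lemma gamma2_le_of_splits:
  fixes d :: "'a \<Rightarrow> 'a \<Rightarrow> real" and t :: "nat \<Rightarrow> 'a \<Rightarrow> real"
  assumes ne: "T \<noteq> {}"
    and d_nonneg: "\<And>x y. x \<in> T \<Longrightarrow> y \<in> T \<Longrightarrow> 0 \<le> d x y"
    and d_sym: "\<And>x y. x \<in> T \<Longrightarrow> y \<in> T \<Longrightarrow> d x y = d y x"
    and d_tri: "\<And>x y z. x \<in> T \<Longrightarrow> y \<in> T \<Longrightarrow> z \<in> T \<Longrightarrow> d x z \<le> d x y + d y z"
    and D: "\<And>x y. x \<in> T \<Longrightarrow> y \<in> T \<Longrightarrow> d x y \<le> D"
    and step: "\<And>k B \<delta>. B \<subseteq> T \<Longrightarrow> (\<And>x y. x \<in> B \<Longrightarrow> y \<in> B \<Longrightarrow> d x y \<le> \<delta>) \<Longrightarrow>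
        splits B (2 ^ (2 ^ \<tau> * 2 ^ k)) (\<lambda>x y. d x y \<le> \<delta> / 8 + t k x)"
    and t_sum: "\<And>x n. x \<in> T \<Longrightarrow> (\<Sum>k<n. sqrt 2 ^ k * t k x) \<le> S"
    and S: "0 \<le> S"
  shows "gamma2 T d \<le> ennreal (2 ^ \<tau> * ((real \<tau> + 2) * D + 6 * S))"
proof -
  obtain x0 where x0: "x0 \<in> T" using ne by auto
  have D0: "0 \<le> D" using D[OF x0 x0] d_nonneg[OF x0 x0] by linarith
  (* Real-valued diameters; T has d-diameter at most D, so the suprema are genuine. *)
  define dm where "dm B = Sup ((\<lambda>(x, y). d x y) ` (B \<times> B))" for B
  have bdd: "bdd_above ((\<lambda>(x, y). d x y) ` (B \<times> B))" if "B \<subseteq> T" for B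
    using D that by (intro bdd_aboveI[of _ D]) auto
  have dm_ub: "d x y \<le> dm B" if "B \<subseteq> T" "x \<in> B" "y \<in> B" for B x y
    unfolding dm_def using bdd[OF that(1)] that by (intro cSup_upper) auto
  have dm_le: "dm B \<le> c" if "B \<noteq> {}" "\<And>x y. x \<in> B \<Longrightarrow> y \<in> B \<Longrightarrow> d x y \<le> c" for B c
    unfolding dm_def using that by (intro cSup_least) auto
  have "\<forall>k B. \<exists>l::'a \<Rightarrow> nat. B \<subseteq> T \<longrightarrow> (\<forall>x\<in>B. l x < 2 ^ (2 ^ \<tau> * 2 ^ k)) \<and>
      (\<forall>x\<in>B. \<forall>y\<in>B. l x = l y \<longrightarrow> d x y \<le> dm B / 8 + t k x)"
  proof (intro allI)
    fix k B
    show "\<exists>l::'a \<Rightarrow> nat. B \<subseteq> T \<longrightarrow> (\<forall>x\<in>B. l x < 2 ^ (2 ^ \<tau> * 2 ^ k)) \<and>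
      (\<forall>x\<in>B. \<forall>y\<in>B. l x = l y \<longrightarrow> d x y \<le> dm B / 8 + t k x)"
    proof (cases "B \<subseteq> T")
      case True
      then show ?thesis using step[OF True dm_ub[OF True], of k] unfolding splits_def by simp
    qed simp
  qed
  then obtain l :: "nat \<Rightarrow> 'a set \<Rightarrow> 'a \<Rightarrow> nat" where
    l: "\<And>k B x. B \<subseteq> T \<Longrightarrow> x \<in> B \<Longrightarrow> l k B x < 2 ^ (2 ^ \<tau> * 2 ^ k)"
       "\<And>k B x y. B \<subseteq> T \<Longrightarrow> x \<in> B \<Longrightarrow> y \<in> B \<Longrightarrow> l k B x = l k B y \<Longrightarrow> d x y \<le> dm B / 8 + t k x"
    by metis
  define cls where
    "cls = rec_nat (\<lambda>_. T) (\<lambda>k c x. {y \<in> c x. l k (c x) y = l k (c x) x})"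
  have cls_0: "cls 0 x = T" for x by (simp add: cls_def)
  have cls_Suc: "cls (Suc k) x = {y \<in> cls k x. l k (cls k x) y = l k (cls k x) x}" for k x
    by (simp add: cls_def)
  have cls_in: "x \<in> cls k x \<and> cls k x \<subseteq> T" if "x \<in> T" for k x
    by (induction k) (use that in \<open>auto simp: cls_0 cls_Suc\<close>)
  have cls_eq: "cls k y = cls k x" if "x \<in> T" "y \<in> cls k x" for k x y
    using that(2) by (induction k) (auto simp: cls_0 cls_Suc)
  have card_cls: "finite (cls k ` T) \<and> card (cls k ` T) \<le> 2 ^ (2 ^ \<tau> * 2 ^ k)" for k
  proof (induction k)
    case 0
    have "cls 0 ` T = {T}" using ne by (auto simp: cls_0)
    then show ?case by simp
  next
    case (Suc k)
    define N :: nat where "N = 2 ^ (2 ^ \<tau> * 2 ^ k)"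
    have "cls (Suc k) ` T \<subseteq> (\<lambda>(B, i). {y \<in> B. l k B y = i}) ` ((cls k ` T) \<times> {..<N})"
    proof
      fix B assume "B \<in> cls (Suc k) ` T"
      then obtain x where x: "x \<in> T" "B = cls (Suc k) x" by auto
      have "(cls k x, l k (cls k x) x) \<in> (cls k ` T) \<times> {..<N}"
        using l(1) cls_in[OF x(1), of k] x(1) by (auto simp: N_def)
      then show "B \<in> (\<lambda>(B, i). {y \<in> B. l k B y = i}) ` ((cls k ` T) \<times> {..<N})"
        unfolding x(2) cls_Suc by (rule rev_image_eqI) simp
    qed
    moreover have "finite ((cls k ` T) \<times> {..<N})" using Suc by simp
    ultimately have "finite (cls (Suc k) ` T)" "card (cls (Suc k) ` T) \<le> card ((cls k ` T) \<times> {..<N})"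
      by (auto intro: finite_surj surj_card_le)
    moreover have "card ((cls k ` T) \<times> {..<N}) \<le> N * N"
      using Suc by (simp add: card_cartesian_product N_def)
    moreover have "N * N = 2 ^ (2 ^ \<tau> * 2 ^ Suc k)"
    proof -
      have "(2::nat) ^ \<tau> * 2 ^ Suc k = 2 ^ \<tau> * 2 ^ k + 2 ^ \<tau> * 2 ^ k" by simp
      then show ?thesis unfolding N_def by (simp only: power_add)
    qed
    ultimately show ?case by (metis order_trans)
  qed
  have part: "partition_on T (cls k ` T)" for k
    by (rule partition_on_classes(1)[OF cls_in cls_eq])
  have cell_cls: "cell (cls k ` T) x = cls k x" if "x \<in> T" for k x
    by (rule partition_on_classes(2)[OF cls_in cls_eq that])
  define \<A> where "\<A> j = cls (j - \<tau>) ` T" for j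
  have "admissible T \<A>"
    unfolding admissible_def
  proof (intro conjI allI)
    fix k
    show "partition_on T (\<A> k)" using part by (simp add: \<A>_def)
    show "finite (\<A> k)" using card_cls by (simp add: \<A>_def)
    show "card (\<A> k) \<le> 2 ^ 2 ^ k"
    proof (cases "\<tau> \<le> k")
      case True
      then have "(2::nat) ^ \<tau> * 2 ^ (k - \<tau>) = 2 ^ k" by (simp flip: power_add)
      then show ?thesis using card_cls[of "k - \<tau>"] by (simp add: \<A>_def)
    next
      case False
      then have "\<A> k = {T}" using ne by (auto simp: \<A>_def cls_0)
      then show ?thesis by simp
    qed
  next
    show "\<A> 0 = {T}" using ne by (auto simp: \<A>_def cls_0)
  next
    fix k
    have sub: "\<exists>Y\<in>\<A> k. X \<subseteq> Y" if X: "X \<in> \<A> (Suc k)" for X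
    proof -
      obtain x where x: "x \<in> T" "X = cls (Suc k - \<tau>) x" using X unfolding \<A>_def by blast
      have "X \<subseteq> cls (k - \<tau>) x"
      proof (cases "\<tau> \<le> k")
        case True
        then show ?thesis unfolding x(2) Suc_diff_le[OF True] cls_Suc by blast
      next
        case False
        then have "Suc k - \<tau> = 0" "k - \<tau> = 0" by auto
        then show ?thesis unfolding x(2) by (simp only: subset_refl)
      qed
      then show ?thesis using x(1) unfolding \<A>_def by blast
    qed
    have "partition_on T (\<A> j)" for j
      using part by (simp add: \<A>_def)
    then show "refines T (\<A> (Suc k)) (\<A> k)"
      unfolding refines_def by (intro conjI ballI sub)
  qed
  moreover have "(\<Sum>k<n. ennreal (2 powr (real k / 2)) * pdiam d (cell (\<A> k) x))
      \<le> ennreal (2 ^ \<tau> * ((real \<tau> + 2) * D + 6 * S))" if x: "x \<in> T" for x n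
  proof -
    define \<delta> where "\<delta> k = dm (cls k x)" for k
    have \<delta>0: "0 \<le> \<delta> k" for k
    proof -
      have "d x x \<le> dm (cls k x)" by (rule dm_ub) (use cls_in[OF x, of k] in auto)
      then show ?thesis using d_nonneg[OF x x] by (simp add: \<delta>_def)
    qed
    have \<delta>D: "\<delta> k \<le> D" for k
      unfolding \<delta>_def by (rule dm_le) (use D cls_in[OF x, of k] in auto)
    have rec: "\<delta> (Suc k) \<le> \<delta> k / 4 + 2 * t k x" for k
      unfolding \<delta>_def
    proof (rule dm_le)
      show "cls (Suc k) x \<noteq> {}" using cls_in[OF x] by auto
      fix y z assume yz: "y \<in> cls (Suc k) x" "z \<in> cls (Suc k) x"
      then have T: "y \<in> T" "z \<in> T" using cls_in[OF x] by auto
      have "d x y \<le> dm (cls k x) / 8 + t k x" "d x z \<le> dm (cls k x) / 8 + t k x"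
        using l(2)[of "cls k x" x y k] l(2)[of "cls k x" x z k] yz cls_in[OF x, of k]
        by (auto simp: cls_Suc)
      moreover have "d y z \<le> d x y + d x z" using d_tri[OF T(1) x T(2)] d_sym[OF x T(1)] by simp
      ultimately show "d y z \<le> dm (cls k x) / 4 + 2 * t k x" by linarith
    qed
    have sq: "sqrt 2 \<le> 3/2" by (rule real_le_lsqrt) (auto simp: power2_eq_square)
    have sum_\<delta>: "(\<Sum>k<n. sqrt 2 ^ k * \<delta> k) \<le> 2 * D + 6 * S" for n
    proof (cases n)
      case (Suc n')
      define A where "A = (\<Sum>k<n'. sqrt 2 ^ k * \<delta> k)"
      have A0: "0 \<le> A" unfolding A_def using \<delta>0 by (intro sum_nonneg) auto
      have A_le: "A \<le> (\<Sum>k<n. sqrt 2 ^ k * \<delta> k)" using \<delta>0 by (simp add: A_def Suc)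
      have "(\<Sum>k<n. sqrt 2 ^ k * \<delta> k) = \<delta> 0 + (\<Sum>k<n'. sqrt 2 ^ Suc k * \<delta> (Suc k))"
        unfolding Suc by (subst sum.lessThan_Suc_shift) simp
      also have "\<dots> \<le> D + (\<Sum>k<n'. sqrt 2 ^ Suc k * (\<delta> k / 4 + 2 * t k x))"
        using rec by (intro add_mono sum_mono mult_left_mono \<delta>D) auto
      also have "(\<Sum>k<n'. sqrt 2 ^ Suc k * (\<delta> k / 4 + 2 * t k x))
          = sqrt 2 / 4 * A + 2 * sqrt 2 * (\<Sum>k<n'. sqrt 2 ^ k * t k x)"
        by (simp add: A_def sum_distrib_left sum.distrib algebra_simps)
      also have "\<dots> \<le> 1 / 2 * A + 3 * S"
      proof (rule add_mono)
        show "sqrt 2 / 4 * A \<le> 1 / 2 * A" using A0 sq by (intro mult_right_mono) auto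
        have "2 * sqrt 2 * (\<Sum>k<n'. sqrt 2 ^ k * t k x) \<le> 2 * sqrt 2 * S"
          using t_sum[OF x] by (intro mult_left_mono) auto
        also have "\<dots> \<le> 3 * S" using sq S by (intro mult_right_mono) auto
        finally show "2 * sqrt 2 * (\<Sum>k<n'. sqrt 2 ^ k * t k x) \<le> 3 * S" .
      qed
      finally show ?thesis using A_le by linarith
    qed (use D0 S in simp)
    have pd: "pdiam d (cell (\<A> k) x) \<le> ennreal (\<delta> (k - \<tau>))" for k
    proof -
      have "cell (\<A> k) x = cls (k - \<tau>) x"
        using cell_cls[OF x] by (simp add: \<A>_def)
      moreover have "d y z \<le> \<delta> (k - \<tau>)" if "y \<in> cls (k - \<tau>) x" "z \<in> cls (k - \<tau>) x" for y z
        unfolding \<delta>_def by (rule dm_ub) (use that cls_in[OF x] in auto)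
      ultimately show ?thesis by (simp add: pdiam_def SUP_le_iff ennreal_leI)
    qed
    have "(\<Sum>k<n. ennreal (2 powr (real k / 2)) * pdiam d (cell (\<A> k) x))
        \<le> (\<Sum>k<\<tau>+n. ennreal (2 powr (real k / 2)) * pdiam d (cell (\<A> k) x))"
      by (intro sum_mono2) auto
    also have "\<dots> \<le> (\<Sum>k<\<tau>+n. ennreal (sqrt 2 ^ k) * ennreal (\<delta> (k - \<tau>)))"
      unfolding two_powr_half by (intro sum_mono mult_left_mono pd) auto
    also have "\<dots> = ennreal (\<Sum>k<\<tau>+n. sqrt 2 ^ k * \<delta> (k - \<tau>))"
      using \<delta>0 by (simp flip: ennreal_mult)
    also have "\<dots> \<le> ennreal (2 ^ \<tau> * ((real \<tau> + 2) * D + 6 * S))"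
    proof (rule ennreal_leI)
      have pw: "sqrt 2 ^ k \<le> 2 ^ \<tau>" if "k \<le> \<tau>" for k
      proof -
        have "sqrt 2 ^ k \<le> (2::real) ^ k" using sq by (intro power_mono) auto
        also have "\<dots> \<le> 2 ^ \<tau>" using that by (intro power_increasing) auto
        finally show ?thesis .
      qed
      have "(\<Sum>k<\<tau>+n. sqrt 2 ^ k * \<delta> (k - \<tau>))
          = (\<Sum>k<\<tau>. sqrt 2 ^ k * \<delta> (k - \<tau>)) + (\<Sum>k<n. sqrt 2 ^ (\<tau> + k) * \<delta> k)"
        by (induction n) simp_all
      also have "(\<Sum>k<n. sqrt 2 ^ (\<tau> + k) * \<delta> k) = sqrt 2 ^ \<tau> * (\<Sum>k<n. sqrt 2 ^ k * \<delta> k)"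
        by (simp add: power_add sum_distrib_left mult.assoc)
      also have "\<dots> \<le> 2 ^ \<tau> * (2 * D + 6 * S)"
        using sum_\<delta> \<delta>0 pw by (intro mult_mono sum_nonneg) auto
      also have "(\<Sum>k<\<tau>. sqrt 2 ^ k * \<delta> (k - \<tau>)) \<le> (\<Sum>k<\<tau>. 2 ^ \<tau> * D)"
        using pw \<delta>D \<delta>0 by (intro sum_mono mult_mono) auto
      also have "(\<Sum>k<\<tau>. 2 ^ \<tau> * D) = 2 ^ \<tau> * (real \<tau> * D)" by simp
      finally show "(\<Sum>k<\<tau>+n. sqrt 2 ^ k * \<delta> (k - \<tau>)) \<le> 2 ^ \<tau> * ((real \<tau> + 2) * D + 6 * S)"
        by (simp add: distrib_left distrib_right)
    qed
    finally show ?thesis .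
  qed
  ultimately show ?thesis by (rule gamma2_leI)
qed

section \<open>Covering an ellipsoid\<close>

definition lattice_ball :: "'i set \<Rightarrow> nat \<Rightarrow> ('i \<Rightarrow> int) set" where
  "lattice_ball J M = {n \<in> PiE J (\<lambda>_. UNIV). (\<Sum>i\<in>J. \<bar>n i\<bar>) \<le> int M}"

lemma sum_two_power_dist: "(\<Sum>a\<in>{- int M..int M}. 2 ^ (M - nat \<bar>a\<bar>)) + 2 = 3 * (2::nat) ^ M"
proof (induction M)
  case (Suc M)
  have eq: "{- int (Suc M)..int (Suc M)} = insert (- int (Suc M)) (insert (int (Suc M)) {- int M..int M})"
    by auto
  have "(\<Sum>a\<in>{- int (Suc M)..int (Suc M)}. 2 ^ (Suc M - nat \<bar>a\<bar>))
      = 2 + (\<Sum>a\<in>{- int M..int M}. (2::nat) ^ (Suc M - nat \<bar>a\<bar>))"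
    unfolding eq by (subst sum.insert; simp)+
  also have "(\<Sum>a\<in>{- int M..int M}. (2::nat) ^ (Suc M - nat \<bar>a\<bar>))
      = (\<Sum>a\<in>{- int M..int M}. 2 * 2 ^ (M - nat \<bar>a\<bar>))"
  proof (rule sum.cong)
    fix a assume "a \<in> {- int M..int M}"
    then have "Suc M - nat \<bar>a\<bar> = Suc (M - nat \<bar>a\<bar>)" by auto
    then show "(2::nat) ^ (Suc M - nat \<bar>a\<bar>) = 2 * 2 ^ (M - nat \<bar>a\<bar>)" by simp
  qed simp
  finally show ?case using Suc by (simp flip: sum_distrib_left)
qed simp

text \<open>
  The first coordinate \<open>a\<close> uses up \<open>|a|\<close> of the budget \<open>M\<close>. Summing the bound for the remaining
  coordinates over \<open>a\<close> costs at most the factor \<open>\<Sum>\<^sub>a 2\<^sup>-\<^sup>|\<^sup>a\<^sup>| = 3\<close>, where \<open>a\<close> ranges over all integers.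
\<close>

lemma card_lattice_ball:
  assumes "finite J"
  shows "finite (lattice_ball J M) \<and> card (lattice_ball J M) \<le> 3 ^ card J * 2 ^ M"
  using assms
proof (induction J arbitrary: M rule: finite_induct)
  case empty
  have "lattice_ball {} M = {\<lambda>_. undefined}" by (auto simp: lattice_ball_def)
  then show ?case by (metis card.empty card.insert_remove empty_iff empty_Diff finite.emptyI finite_insert
    mult_1 one_le_numeral one_le_power power_0 One_nat_def)
next
  case (insert j J)
  define P where "P = (SIGMA a:{- int M..int M}. lattice_ball J (M - nat \<bar>a\<bar>))"
  have fin: "finite P" unfolding P_def using insert.IH by auto
  have sub: "lattice_ball (insert j J) M \<subseteq> (\<lambda>(a, n). n(j := a)) ` P"
  proof
    fix n assume n: "n \<in> lattice_ball (insert j J) M"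
    define n' where "n' = n(j := undefined)"
    have sum: "\<bar>n j\<bar> + (\<Sum>i\<in>J. \<bar>n i\<bar>) \<le> int M"
      using n insert.hyps by (simp add: lattice_ball_def)
    have nn: "0 \<le> (\<Sum>i\<in>J. \<bar>n i\<bar>)" by (rule sum_nonneg) simp
    have "(\<Sum>i\<in>J. \<bar>n' i\<bar>) = (\<Sum>i\<in>J. \<bar>n i\<bar>)"
      using insert.hyps by (intro sum.cong) (auto simp: n'_def)
    moreover have "int (M - nat \<bar>n j\<bar>) = int M - \<bar>n j\<bar>" using sum nn by linarith
    moreover have "n' \<in> PiE J (\<lambda>_. UNIV)"
      using n insert.hyps by (auto simp: lattice_ball_def n'_def PiE_iff extensional_def)
    ultimately have "n' \<in> lattice_ball J (M - nat \<bar>n j\<bar>)" using sum by (simp add: lattice_ball_def)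
    moreover have "n j \<in> {- int M..int M}" unfolding atLeastAtMost_iff using sum nn by linarith
    ultimately have "(n j, n') \<in> P" by (simp add: P_def)
    then show "n \<in> (\<lambda>(a, n). n(j := a)) ` P" by (rule rev_image_eqI) (simp add: n'_def)
  qed
  have "card (lattice_ball (insert j J) M) \<le> card P"
    using surj_card_le[OF fin sub] .
  also have "\<dots> = (\<Sum>a\<in>{- int M..int M}. card (lattice_ball J (M - nat \<bar>a\<bar>)))"
    unfolding P_def using insert.IH by (intro card_SigmaI) auto
  also have "\<dots> \<le> (\<Sum>a\<in>{- int M..int M}. 3 ^ card J * 2 ^ (M - nat \<bar>a\<bar>))"
    using insert.IH by (intro sum_mono) auto
  also have "\<dots> = 3 ^ card J * (\<Sum>a\<in>{- int M..int M}. 2 ^ (M - nat \<bar>a\<bar>))"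
    by (simp add: sum_distrib_left)
  also have "\<dots> \<le> 3 ^ card J * (3 * 2 ^ M)"
    using sum_two_power_dist[of M] by (intro mult_left_mono) linarith+
  finally show ?case using insert.hyps finite_surj[OF fin sub] by simp
qed

text \<open>
  For nonnegative \<open>w\<close> and \<open>N > 0\<close> this is the least \<open>\<theta> \<ge> 0\<close> with \<open>\<Sum>\<^sub>i max (w\<^sub>i - \<theta>) 0 \<le> N \<theta>\<close>. For \<open>N = 2\<^sup>k\<close> it
  is an upper bound, up to constants, for the diameter of the pieces when the ellipsoid with semiaxes
  \<open>w\<close> is covered by \<open>2\<close> to the power \<open>O(2\<^sup>k)\<close> pieces. The expression as a maximum makes it evident that it is Lipschitz in
  \<open>w\<close> and decreasing in \<open>N\<close>.
\<close>

definition ell_num :: "'i set \<Rightarrow> ('i \<Rightarrow> real) \<Rightarrow> real \<Rightarrow> real" where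
  "ell_num I w N = Max ((\<lambda>J. sum w J / (N + real (card J))) ` Pow I)"

lemma ell_num_ge:
  assumes "finite I" "J \<subseteq> I"
  shows "sum w J / (N + real (card J)) \<le> ell_num I w N"
  unfolding ell_num_def using assms by (intro Max_ge) auto

lemma ell_num_attained:
  assumes "finite I"
  obtains J where "J \<subseteq> I" "ell_num I w N = sum w J / (N + real (card J))"
proof -
  have "ell_num I w N \<in> (\<lambda>J. sum w J / (N + real (card J))) ` Pow I"
    unfolding ell_num_def using assms by (intro Max_in) auto
  then show ?thesis using that by auto
qed

lemma ell_num_nonneg: "finite I \<Longrightarrow> 0 \<le> ell_num I w N"
  using ell_num_ge[of I "{}" w N] by simp

lemma ell_num_antimono:
  assumes "finite I" "\<And>i. i \<in> I \<Longrightarrow> 0 \<le> w i" "0 < N" "N \<le> N'"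
  shows "ell_num I w N' \<le> ell_num I w N"
proof -
  obtain J where J: "J \<subseteq> I" "ell_num I w N' = sum w J / (N' + real (card J))"
    using ell_num_attained[OF assms(1)] by blast
  have "sum w J / (N' + real (card J)) \<le> sum w J / (N + real (card J))"
    using assms J by (intro divide_left_mono sum_nonneg mult_pos_pos) (auto intro: add_pos_nonneg)
  then show ?thesis using ell_num_ge[OF assms(1) J(1), of w N] J(2) by simp
qed

lemma ell_num_lipschitz:
  assumes "finite I" "0 < N" "\<And>i. i \<in> I \<Longrightarrow> w' i \<le> w i + \<Delta>" "0 \<le> \<Delta>"
  shows "ell_num I w' N \<le> ell_num I w N + \<Delta>"
proof -
  obtain J where J: "J \<subseteq> I" "ell_num I w' N = sum w' J / (N + real (card J))"
    using ell_num_attained[OF assms(1)] by blast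
  have "sum w' J \<le> (\<Sum>i\<in>J. w i + \<Delta>)" using assms J by (intro sum_mono) auto
  also have "\<dots> \<le> sum w J + (N + real (card J)) * \<Delta>"
    using assms by (simp add: sum.distrib algebra_simps)
  finally have "sum w' J / (N + real (card J)) \<le> (sum w J + (N + real (card J)) * \<Delta>) / (N + real (card J))"
    using assms by (intro divide_right_mono) auto
  also have "\<dots> = sum w J / (N + real (card J)) + \<Delta>"
  proof -
    have "N + real (card J) \<noteq> 0" using assms(2) by linarith
    then show ?thesis by (simp add: field_simps)
  qed
  also have "\<dots> \<le> ell_num I w N + \<Delta>" using ell_num_ge[OF assms(1) J(1), of w N] by simp
  finally show ?thesis using J(2) by simp
qed

lemma ell_num_tail:
  assumes "finite I" "J \<subseteq> I" "0 < N" "ell_num I w N \<le> \<theta>"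
  shows "(\<Sum>i\<in>J. w i - \<theta>) \<le> N * \<theta>"
proof -
  have "sum w J / (N + real (card J)) \<le> \<theta>" using ell_num_ge[OF assms(1,2), of w N] assms(4) by simp
  then have "sum w J \<le> \<theta> * (N + real (card J))"
    using assms(3) by (simp add: pos_divide_le_eq add_pos_nonneg)
  then show ?thesis by (simp add: sum_subtractf algebra_simps)
qed

text \<open>
  For a maximising \<open>J\<close> the sum of \<open>w\<^sub>i - e\<close> over \<open>J\<close> equals \<open>N e\<close>, where \<open>e\<close> is the maximum, and only
  indices with \<open>w\<^sub>i \<ge> e\<close> contribute a positive amount.
\<close>

lemma ell_num_self:
  assumes "finite I" "\<And>i. i \<in> I \<Longrightarrow> 0 \<le> w i" "0 < N"
  shows "N * ell_num I w N \<le> (\<Sum>i\<in>{i\<in>I. ell_num I w N \<le> w i}. w i)"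
proof -
  define e where "e = ell_num I w N"
  obtain J where J: "J \<subseteq> I" "e = sum w J / (N + real (card J))"
    using ell_num_attained[OF assms(1)] unfolding e_def by blast
  have e0: "0 \<le> e" unfolding e_def by (rule ell_num_nonneg[OF assms(1)])
  have "N + real (card J) \<noteq> 0" using assms(3) by linarith
  then have "sum w J = e * (N + real (card J))" using J(2) by simp
  then have "N * e = (\<Sum>i\<in>J. w i - e)" by (simp add: sum_subtractf algebra_simps)
  also have "\<dots> \<le> (\<Sum>i\<in>J. if e \<le> w i then w i else 0)" using e0 by (intro sum_mono) auto
  also have "\<dots> \<le> (\<Sum>i\<in>I. if e \<le> w i then w i else 0)"
    using assms J by (intro sum_mono2) auto
  also have "\<dots> = (\<Sum>i\<in>{i\<in>I. e \<le> w i}. w i)" using assms(1) by (simp add: sum.inter_filter)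
  finally show ?thesis by (simp add: e_def)
qed

lemma sum_below_threshold:
  fixes e :: "nat \<Rightarrow> real"
  assumes "\<And>k. e (Suc k) \<le> e k" "\<And>k. 0 \<le> e k" "0 \<le> w"
  shows "(\<Sum>k<n. if e k \<le> w then e k - e (Suc k) else 0) \<le> w"
proof -
  have "(\<Sum>k<n. if e k \<le> w then e k - e (Suc k) else 0) + min w (e n) \<le> w"
  proof (induction n)
    case (Suc n)
    then show ?case using assms(1)[of n] by (auto split: if_splits)
  qed simp
  moreover have "0 \<le> min w (e n)" using assms by simp
  ultimately show ?thesis by linarith
qed

text \<open>
  Summation by parts turns the left side into \<open>\<Sum>\<^sub>k 2\<^sup>k e\<^sub>k (e\<^sub>k - e\<^sub>k\<^sub>+\<^sub>1)\<close>, up to constants. Here \<open>2\<^sup>k e\<^sub>k\<close> is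
  at most the sum of the \<open>w\<^sub>i \<ge> e\<^sub>k\<close>, and for fixed \<open>i\<close> the differences with \<open>e\<^sub>k \<le> w\<^sub>i\<close> telescope to at
  most \<open>w\<^sub>i\<close>.
\<close>

lemma sum_ell_num:
  assumes "finite I" "\<And>i. i \<in> I \<Longrightarrow> 0 \<le> w i"
  shows "(\<Sum>k<n. 2 ^ k * (ell_num I w (2 ^ k))\<^sup>2) \<le> 4 * (\<Sum>i\<in>I. (w i)\<^sup>2)"
proof -
  (* Cut off at n, so that summation by parts leaves no boundary term. *)
  define e where "e k = (if k < n then ell_num I w (2 ^ k) else 0)" for k
  have e0: "0 \<le> e k" for k using ell_num_nonneg[OF assms(1)] by (simp add: e_def)
  have dec: "e (Suc k) \<le> e k" for k
    using ell_num_antimono[OF assms(1), of w "2 ^ k" "2 ^ Suc k"] assms(2)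
      ell_num_nonneg[OF assms(1), of w "2 ^ k"] by (simp add: e_def)
  have abel: "(\<Sum>k<n. 2 ^ k * (e k)\<^sup>2) \<le> (\<Sum>k<n. 4 * ((2 ^ k * e k) * (e k - e (Suc k)))) + 2 ^ n * (e n)\<^sup>2"
    for n
  proof (induction n)
    case (Suc n)
    have "(e n)\<^sup>2 - (e (Suc n))\<^sup>2 \<le> 2 * (e n * (e n - e (Suc n)))"
      using zero_le_power2[of "e n - e (Suc n)"] by (simp add: power2_eq_square algebra_simps)
    then have "2 * 2 ^ n * ((e n)\<^sup>2 - (e (Suc n))\<^sup>2) \<le> 2 * 2 ^ n * (2 * (e n * (e n - e (Suc n))))"
      by (intro mult_left_mono) auto
    then show ?case using Suc by (simp add: algebra_simps)
  qed (use e0 in simp)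
  have "(\<Sum>k<n. 4 * ((2 ^ k * e k) * (e k - e (Suc k)))) \<le> 4 * (\<Sum>i\<in>I. (w i)\<^sup>2)"
  proof -
    have "(\<Sum>k<n. (2 ^ k * e k) * (e k - e (Suc k)))
        \<le> (\<Sum>k<n. (\<Sum>i\<in>I. if e k \<le> w i then w i else 0) * (e k - e (Suc k)))"
    proof (intro sum_mono mult_right_mono)
      fix k
      show "2 ^ k * e k \<le> (\<Sum>i\<in>I. if e k \<le> w i then w i else 0)"
      proof (cases "k < n")
        case True
        then show ?thesis using ell_num_self[OF assms(1), of w "2 ^ k"] assms
          by (simp add: e_def sum.inter_filter)
      qed (use assms(2) in \<open>auto simp: e_def intro!: sum_nonneg\<close>)
      show "0 \<le> e k - e (Suc k)" using dec[of k] by simp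
    qed
    also have "\<dots> = (\<Sum>i\<in>I. \<Sum>k<n. w i * (if e k \<le> w i then e k - e (Suc k) else 0))"
      unfolding sum_distrib_right
      by (subst sum.swap) (auto intro!: sum.cong)
    also have "\<dots> \<le> (\<Sum>i\<in>I. w i * w i)"
      unfolding sum_distrib_left[symmetric]
      using assms by (intro sum_mono mult_left_mono sum_below_threshold dec e0) auto
    finally show ?thesis by (simp add: power2_eq_square flip: sum_distrib_left)
  qed
  moreover have "(\<Sum>k<n. 2 ^ k * (ell_num I w (2 ^ k))\<^sup>2) = (\<Sum>k<n. 2 ^ k * (e k)\<^sup>2)"
    by (simp add: e_def)
  ultimately show ?thesis using abel[of n] by (simp add: e_def)
qed

text \<open>
  Only the coordinates \<open>J\<close> with \<open>w\<^sub>i > 2 \<theta>\<close> need to be resolved; there are at most \<open>2\<^sup>k\<close> of them, with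
  \<open>\<Sum> w\<^sub>i \<le> 2 * 2\<^sup>k \<theta>\<close>. Rounding coordinate \<open>i\<close> to a grid of width proportional to \<open>w\<^sub>i\<^sup>-\<^sup>1\<^sup>/\<^sup>2\<close> balances both
  requirements: the weighted error is of order \<open>\<theta> X\<close>, and by Cauchy--Schwarz the integer codes have
  \<open>l\<^sup>1\<close>-norm of order \<open>2\<^sup>k\<close>, so that there are few codes.
\<close>

lemma splits_ellipsoid:
  fixes x :: "'a \<Rightarrow> 'i \<Rightarrow> real"
  assumes I: "finite I" and w: "\<And>i. i \<in> I \<Longrightarrow> 0 \<le> w i"
    and \<theta>: "ell_num I w (2 ^ k) \<le> \<theta>"
    and X: "\<And>y y'. y \<in> S \<Longrightarrow> y' \<in> S \<Longrightarrow> L2_set (\<lambda>i. x y i - x y' i) I \<le> X"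
  shows "splits S (2 ^ (5 * 2 ^ k)) (\<lambda>y y'. L2_set (\<lambda>i. w i * (x y i - x y' i)) I \<le> 3 * \<theta> * X)"
proof (cases "S = {}")
  case True
  then show ?thesis by (auto simp: splits_def)
next
  case False
  then obtain y0 where y0: "y0 \<in> S" by auto
  have X0: "0 \<le> X" using X[OF y0 y0] L2_set_nonneg order_trans by blast
  have \<theta>0: "0 \<le> \<theta>" using ell_num_nonneg[OF I] \<theta> order_trans by blast
  define J where "J = {i\<in>I. 2 * \<theta> < w i}"
  have J: "J \<subseteq> I" "finite J" using I by (auto simp: J_def)
  have "sum w J / 2 = (\<Sum>i\<in>J. w i / 2)" by (simp add: sum_divide_distrib)
  also have "\<dots> \<le> (\<Sum>i\<in>J. w i - \<theta>)" by (intro sum_mono) (auto simp: J_def)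
  also have "\<dots> \<le> 2 ^ k * \<theta>" using ell_num_tail[OF I J(1) _ \<theta>] by simp
  finally have sumJ: "sum w J \<le> 2 * 2 ^ k * \<theta>" by simp
  have "2 * \<theta> * card J \<le> sum w J"
    using sum_bounded_below[of J "2 * \<theta>" w] by (auto simp: J_def algebra_simps)
  with sumJ have cJ: "\<theta> * card J \<le> \<theta> * 2 ^ k" by (simp add: algebra_simps)
  \<comment> \<open>weights above the threshold force it to be positive\<close>
  have \<theta>J: "0 < \<theta>" if "J \<noteq> {}"
  proof (rule ccontr)
    assume "\<not> 0 < \<theta>"
    then have "\<theta> = 0" using \<theta>0 by simp
    then have "sum w J \<le> 0" using sumJ by simp
    moreover have "0 < sum w J" using J that \<open>\<theta> = 0\<close> by (intro sum_pos) (auto simp: J_def)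
    ultimately show False by simp
  qed
  have cardJ: "card J \<le> 2 ^ k"
  proof (cases "J = {}")
    case False
    then have "real (card J) \<le> real (2 ^ k)" using cJ \<theta>J by simp
    then show ?thesis by (simp only: of_nat_le_iff)
  qed simp
  show ?thesis
  proof (cases "X = 0")
    case True
    have "L2_set (\<lambda>i. w i * (x y i - x y' i)) I \<le> 3 * \<theta> * X" if "y \<in> S" "y' \<in> S" for y y'
    proof -
      have "L2_set (\<lambda>i. x y i - x y' i) I = 0"
        using X[OF that] True L2_set_nonneg[of "\<lambda>i. x y i - x y' i" I] by linarith
      then have "\<forall>i\<in>I. x y i - x y' i = 0" using I by (simp add: L2_set_eq_0_iff)
      then have "L2_set (\<lambda>i. w i * (x y i - x y' i)) I = 0" using I by (simp add: L2_set_eq_0_iff)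
      then show ?thesis using True by simp
    qed
    then show ?thesis unfolding splits_def by (intro exI[of _ "\<lambda>_. 0"]) auto
  next
    case False
    then have Xpos: "0 < X" using X0 by simp
    define g where "g i = sqrt (2 ^ k * (w i / \<theta>)) / X" for i
    have g0: "0 < g i" if "i \<in> J" for i
    proof -
      have "0 < \<theta>" "0 < w i" using that \<theta>J \<theta>0 by (auto simp: J_def)
      then show ?thesis using Xpos by (simp add: g_def)
    qed
    have g2: "(g i)\<^sup>2 = 2 ^ k * (w i / \<theta>) / X\<^sup>2" if "i \<in> J" for i
      using w that J \<theta>0 by (auto simp: g_def power_divide)
    define c where "c y = restrict (\<lambda>i. \<lfloor>g i * (x y i - x y0 i)\<rfloor>) J" for y
    show ?thesis
    proof (rule splits_by_code[where V = "lattice_ball J (3 * 2 ^ k)" and c = c])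
      show "finite (lattice_ball J (3 * 2 ^ k))" using card_lattice_ball[OF J(2)] by blast
      have "card (lattice_ball J (3 * 2 ^ k)) \<le> 3 ^ card J * 2 ^ (3 * 2 ^ k)"
        using card_lattice_ball[OF J(2)] by blast
      also have "\<dots> \<le> (2 ^ 2) ^ 2 ^ k * 2 ^ (3 * 2 ^ k)"
      proof (intro mult_right_mono)
        have "(3::nat) ^ card J \<le> 4 ^ card J" by (rule power_mono) auto
        also have "\<dots> \<le> 4 ^ 2 ^ k" using cardJ by (intro power_increasing) auto
        finally show "(3::nat) ^ card J \<le> (2 ^ 2) ^ 2 ^ k" by simp
      qed simp
      also have "\<dots> = 2 ^ (2 * 2 ^ k + 3 * 2 ^ k)" by (simp only: power_mult power_add)
      finally show "card (lattice_ball J (3 * 2 ^ k)) \<le> 2 ^ (5 * 2 ^ k)" by (simp add: algebra_simps)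
    next
      fix y assume y: "y \<in> S"
      define h where "h i = x y i - x y0 i" for i
      have "(\<Sum>i\<in>J. g i * \<bar>h i\<bar>) \<le> L2_set g J * L2_set h J"
      proof -
        have "(\<Sum>i\<in>J. g i * \<bar>h i\<bar>) = (\<Sum>i\<in>J. \<bar>g i\<bar> * \<bar>h i\<bar>)"
          using g0 by (intro sum.cong) (auto simp: abs_of_pos)
        then show ?thesis using L2_set_mult_ineq[where f = g and g = h and A = J] by simp
      qed
      also have "\<dots> \<le> (2 * 2 ^ k / X) * X"
      proof (rule mult_mono)
        have "(\<Sum>i\<in>J. (g i)\<^sup>2) = (2 ^ k / X\<^sup>2) * (sum w J / \<theta>)"
          unfolding sum_divide_distrib sum_distrib_left by (intro sum.cong refl) (simp add: g2)
        also have "\<dots> \<le> (2 ^ k / X\<^sup>2) * (2 * 2 ^ k)"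
          using sumJ \<theta>J \<theta>0 by (intro mult_left_mono) (cases "J = {}"; auto simp: divide_simps)+
        also have "\<dots> \<le> (2 * 2 ^ k / X)\<^sup>2" by (simp add: power2_eq_square divide_simps)
        finally show "L2_set g J \<le> 2 * 2 ^ k / X"
          unfolding L2_set_def using Xpos by (intro real_le_lsqrt) (auto intro: sum_nonneg)
        have "L2_set h J \<le> L2_set h I"
          unfolding L2_set_def using J I by (intro real_sqrt_le_mono sum_mono2) auto
        then show "L2_set h J \<le> X" using X[OF y y0] by (simp add: h_def[abs_def])
      qed (use Xpos in auto)
      finally have gh: "(\<Sum>i\<in>J. g i * \<bar>h i\<bar>) \<le> 2 * 2 ^ k" using Xpos by simp
      have "real_of_int (\<Sum>i\<in>J. \<bar>c y i\<bar>) \<le> (\<Sum>i\<in>J. g i * \<bar>h i\<bar> + 1)"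
        unfolding of_int_sum
      proof (rule sum_mono)
        fix i assume i: "i \<in> J"
        have "\<bar>g i * h i\<bar> = g i * \<bar>h i\<bar>" using g0[OF i] by (simp add: abs_mult)
        moreover have "real_of_int \<bar>c y i\<bar> \<le> \<bar>g i * h i\<bar> + 1"
          using i by (simp add: c_def h_def) linarith
        ultimately show "real_of_int \<bar>c y i\<bar> \<le> g i * \<bar>h i\<bar> + 1" by simp
      qed
      also have "\<dots> = (\<Sum>i\<in>J. g i * \<bar>h i\<bar>) + card J" by (simp add: sum.distrib)
      also have "\<dots> \<le> 2 * 2 ^ k + 2 ^ k"
      proof (rule add_mono[OF gh])
        have "real (card J) \<le> real (2 ^ k)" using cardJ by (simp only: of_nat_le_iff)
        then show "real (card J) \<le> 2 ^ k" by simp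
      qed
      finally have "real_of_int (\<Sum>i\<in>J. \<bar>c y i\<bar>) \<le> real_of_int (3 * 2 ^ k)" by simp
      then have "(\<Sum>i\<in>J. \<bar>c y i\<bar>) \<le> 3 * 2 ^ k" by (simp only: of_int_le_iff)
      then show "c y \<in> lattice_ball J (3 * 2 ^ k)" by (auto simp: lattice_ball_def c_def)
    next
      fix y y' assume y: "y \<in> S" "y' \<in> S" and cc: "c y = c y'"
      define h where "h i = x y i - x y' i" for i
      have hJ: "(w i * h i)\<^sup>2 \<le> w i * \<theta> * X\<^sup>2 / 2 ^ k" if i: "i \<in> J" for i
      proof -
        have "c y i = c y' i" using cc by simp
        then have "\<lfloor>g i * (x y i - x y0 i)\<rfloor> = \<lfloor>g i * (x y' i - x y0 i)\<rfloor>" using i by (simp add: c_def)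
        then have "\<bar>g i * (x y i - x y0 i) - g i * (x y' i - x y0 i)\<bar> \<le> 1" by linarith
        then have "\<bar>g i * h i\<bar> \<le> 1" by (simp add: h_def algebra_simps)
        then have "(g i * h i)\<^sup>2 \<le> 1" by (simp add: abs_square_le_1)
        then have "2 ^ k * (w i / \<theta>) / X\<^sup>2 * (h i)\<^sup>2 \<le> 1" by (simp add: power_mult_distrib g2[OF i])
        moreover have "0 < \<theta>" "0 < w i" using \<theta>J i \<theta>0 by (auto simp: J_def)
        ultimately show ?thesis using Xpos
          by (simp add: field_simps power2_eq_square)
      qed
      have "(\<Sum>i\<in>J. (w i * h i)\<^sup>2) \<le> (\<Sum>i\<in>J. w i * (\<theta> * X\<^sup>2 / 2 ^ k))"
        using hJ by (intro sum_mono) (simp add: mult.assoc)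
      also have "\<dots> = sum w J * (\<theta> * X\<^sup>2 / 2 ^ k)" by (simp only: sum_distrib_right)
      also have "\<dots> \<le> (2 * 2 ^ k * \<theta>) * (\<theta> * X\<^sup>2 / 2 ^ k)"
        using sumJ \<theta>0 by (intro mult_right_mono) auto
      also have "\<dots> = 2 * (\<theta> * X)\<^sup>2" by (simp add: power2_eq_square)
      finally have s1: "(\<Sum>i\<in>J. (w i * h i)\<^sup>2) \<le> 2 * (\<theta> * X)\<^sup>2" .
      have "(\<Sum>i\<in>I - J. (w i * h i)\<^sup>2) \<le> (\<Sum>i\<in>I - J. (2 * \<theta>)\<^sup>2 * (h i)\<^sup>2)"
        unfolding power_mult_distrib[of "w _"]
        using w by (intro sum_mono mult_right_mono power_mono) (auto simp: J_def)
      also have "\<dots> \<le> (2 * \<theta>)\<^sup>2 * (\<Sum>i\<in>I. (h i)\<^sup>2)"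
        unfolding sum_distrib_left[symmetric] using I by (intro mult_left_mono sum_mono2) auto
      also have "(\<Sum>i\<in>I. (h i)\<^sup>2) \<le> X\<^sup>2"
      proof -
        have "sqrt (\<Sum>i\<in>I. (h i)\<^sup>2) \<le> X" using X[OF y] by (simp add: h_def L2_set_def)
        then show ?thesis by (simp add: sqrt_le_D)
      qed
      finally have s2: "(\<Sum>i\<in>I - J. (w i * h i)\<^sup>2) \<le> 4 * (\<theta> * X)\<^sup>2"
        by (simp add: power_mult_distrib mult_left_mono)
      have "(\<Sum>i\<in>I. (w i * h i)\<^sup>2) = (\<Sum>i\<in>I - J. (w i * h i)\<^sup>2) + (\<Sum>i\<in>J. (w i * h i)\<^sup>2)"
        using J(1) I by (rule sum.subset_diff)
      also have "\<dots> \<le> 9 * (\<theta> * X)\<^sup>2" using s1 s2 zero_le_power2[of "\<theta> * X"] by linarith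
      also have "\<dots> = (3 * \<theta> * X)\<^sup>2" by (simp add: power_mult_distrib)
      finally show "L2_set (\<lambda>i. w i * (x y i - x y' i)) I \<le> 3 * \<theta> * X"
        unfolding L2_set_def h_def using \<theta>0 X0 by (intro real_le_lsqrt) (auto intro: sum_nonneg)
    qed
  qed
qed

section \<open>Interpolation\<close>

text \<open>
  The abstract situation: \<open>d\<close> is to be chained, \<open>e\<close> is the Euclidean distance with squared norm \<open>q\<close>,
  and \<open>mid\<close> is a mean with respect to which \<open>q\<close> is uniformly convex, and which is no further away in
  \<open>d\<close>, or in terms of \<open>\<phi>\<close>, than the two points are from each other. The sizes \<open>\<phi>\<^sub>k\<close> measure both the
  \<open>\<rho>\<close>-distance to a net and the entropy of the local ellipsoid at level \<open>k\<close>. The assumption \<open>\<phi>_regular\<close>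
  makes \<open>\<Sum>\<^sub>j\<^sub>\<le>\<^sub>k 2\<^sup>j \<phi>\<^sub>j\<close> of order \<open>2\<^sup>k \<phi>\<^sub>k\<close>, so that perturbing \<open>\<phi>\<close> by \<open>\<theta>\<close> where \<open>\<phi>\<^sub>k \<le> \<theta>\<close> changes
  \<open>\<Sum>\<^sub>j\<^sub>\<le>\<^sub>k 2\<^sup>j \<phi>\<^sub>j\<^sup>2\<close> by no more than the order of \<open>2\<^sup>k \<theta>\<^sup>2\<close>.
\<close>

locale interpolation =
  fixes K :: "'a set" and d \<rho> e :: "'a \<Rightarrow> 'a \<Rightarrow> real" and q :: "'a \<Rightarrow> real"
    and mid :: "'a \<Rightarrow> 'a \<Rightarrow> 'a" and \<phi> :: "nat \<Rightarrow> 'a \<Rightarrow> real" and M :: real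
  assumes M_pos: "0 < M"
    and d_nonneg: "\<And>x y. x \<in> K \<Longrightarrow> y \<in> K \<Longrightarrow> 0 \<le> d x y"
    and d_self: "\<And>x. x \<in> K \<Longrightarrow> d x x = 0"
    and d_sym: "\<And>x y. x \<in> K \<Longrightarrow> y \<in> K \<Longrightarrow> d x y = d y x"
    and d_tri: "\<And>x y z. x \<in> K \<Longrightarrow> y \<in> K \<Longrightarrow> z \<in> K \<Longrightarrow> d x z \<le> d x y + d y z"
    and q_bounds: "\<And>x. x \<in> K \<Longrightarrow> 0 \<le> q x \<and> q x \<le> 2"
    and mid_in: "\<And>x y. x \<in> K \<Longrightarrow> y \<in> K \<Longrightarrow> mid x y \<in> K"
    and mid_sym: "\<And>x y. mid x y = mid y x"
    and d_mid: "\<And>x y. x \<in> K \<Longrightarrow> y \<in> K \<Longrightarrow> d x (mid x y) \<le> d x y"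
    and q_mid: "\<And>x y. x \<in> K \<Longrightarrow> y \<in> K \<Longrightarrow> 2 * q (mid x y) = q x + q y - (e x y)\<^sup>2"
    and \<rho>_sym: "\<And>x y. x \<in> K \<Longrightarrow> y \<in> K \<Longrightarrow> \<rho> x y = \<rho> y x"
    and \<phi>_nonneg: "\<And>k x. x \<in> K \<Longrightarrow> 0 \<le> \<phi> k x"
    and \<phi>_mid: "\<And>k x y. x \<in> K \<Longrightarrow> y \<in> K \<Longrightarrow> \<phi> k (mid x y) \<le> \<phi> k x + 2 * \<rho> x y"
    and \<phi>_regular: "\<And>k x. x \<in> K \<Longrightarrow> \<phi> k x \<le> 3 / 2 * \<phi> (Suc k) x"
    and \<phi>_sum: "\<And>n x. x \<in> K \<Longrightarrow> (\<Sum>k<n. 2 ^ k * (\<phi> k x)\<^sup>2) \<le> M\<^sup>2"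
    and \<phi>_net: "\<And>k. splits K (2 ^ 2 ^ k) (\<lambda>x y. \<rho> x y \<le> \<phi> k x + \<phi> k y)"
    and d_cover: "\<And>k S \<theta> X. S \<subseteq> K \<Longrightarrow> (\<And>x. x \<in> S \<Longrightarrow> \<phi> k x \<le> \<theta>) \<Longrightarrow>
        (\<And>x y. x \<in> S \<Longrightarrow> y \<in> S \<Longrightarrow> \<rho> x y \<le> 2 * \<theta>) \<Longrightarrow>
        (\<And>x y. x \<in> S \<Longrightarrow> y \<in> S \<Longrightarrow> e x y \<le> X) \<Longrightarrow>
        splits S (2 ^ (5 * 2 ^ k)) (\<lambda>x y. d x y \<le> 12 * \<theta> * X)"
begin

text \<open>
  Penalising \<open>\<phi>\<close> along with the norm is what controls \<open>\<phi>\<^sub>k\<close> at the points \<open>near k z\<close>, which move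
  with \<open>k\<close>: the square sum of \<open>\<phi>\<close> is given only along a fixed point.
\<close>

definition pen :: "nat \<Rightarrow> 'a \<Rightarrow> real" where
  "pen k y = M * q y + (\<Sum>j<Suc k. 2 ^ j * (\<phi> j y)\<^sup>2) / M"

definition cost :: "nat \<Rightarrow> 'a \<Rightarrow> 'a \<Rightarrow> real" where
  "cost k z y = pen k y + sqrt 2 ^ k * d z y"

definition opt :: "nat \<Rightarrow> 'a \<Rightarrow> real" where
  "opt k z = (INF y\<in>K. cost k z y)"

text \<open>
  The infimum need not be attained; the tolerance \<open>M / 2\<^sup>k\<close> is summable and negligible in all
  estimates below.
\<close>

definition near :: "nat \<Rightarrow> 'a \<Rightarrow> 'a" where
  "near k z = (SOME y. y \<in> K \<and> cost k z y \<le> opt k z + M / 2 ^ k)"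

abbreviation s :: "nat \<Rightarrow> 'a \<Rightarrow> real" where "s k z \<equiv> d z (near k z)"
abbreviation p :: "nat \<Rightarrow> 'a \<Rightarrow> real" where "p k z \<equiv> \<phi> k (near k z)"

lemma pen_nonneg: "y \<in> K \<Longrightarrow> 0 \<le> pen k y"
  unfolding pen_def using q_bounds M_pos
  by (intro add_nonneg_nonneg divide_nonneg_pos mult_nonneg_nonneg sum_nonneg) auto

lemma pen_le: 
  assumes "y \<in> K" shows "pen k y \<le> 3 * M"
proof -
  have "M * q y \<le> M * 2" using q_bounds[OF assms] M_pos by (intro mult_left_mono) auto
  moreover have "(\<Sum>j<Suc k. 2 ^ j * (\<phi> j y)\<^sup>2) / M \<le> M\<^sup>2 / M"
    using \<phi>_sum[OF assms, of "Suc k"] M_pos by (intro divide_right_mono) auto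
  moreover have "M\<^sup>2 / M = M" using M_pos by (simp add: power2_eq_square)
  ultimately show ?thesis unfolding pen_def by linarith
qed

lemma cost_nonneg: "z \<in> K \<Longrightarrow> y \<in> K \<Longrightarrow> 0 \<le> cost k z y"
  unfolding cost_def using pen_nonneg d_nonneg by (intro add_nonneg_nonneg mult_nonneg_nonneg) auto

lemma opt_le: "z \<in> K \<Longrightarrow> y \<in> K \<Longrightarrow> opt k z \<le> cost k z y"
  unfolding opt_def using cost_nonneg by (intro cINF_lower bdd_belowI2[of _ 0]) auto

lemma opt_upper: "z \<in> K \<Longrightarrow> opt k z \<le> 3 * M"
  using opt_le[of z z k] pen_le[of z k] d_self[of z] by (simp add: cost_def)

lemma near:
  assumes "z \<in> K"
  shows "near k z \<in> K" and "cost k z (near k z) \<le> opt k z + M / 2 ^ k"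
proof -
  have "opt k z < opt k z + M / 2 ^ k" using M_pos by simp
  moreover have "cost k z ` K \<noteq> {}" using assms by auto
  ultimately have "\<exists>c\<in>cost k z ` K. c < opt k z + M / 2 ^ k"
    unfolding opt_def by (intro cInf_lessD)
  then have "\<exists>y. y \<in> K \<and> cost k z y \<le> opt k z + M / 2 ^ k" by force
  from someI_ex[OF this] show "near k z \<in> K" "cost k z (near k z) \<le> opt k z + M / 2 ^ k"
    unfolding near_def by auto
qed

lemma s_nonneg: "z \<in> K \<Longrightarrow> 0 \<le> s k z"
  using d_nonneg near(1) by simp

lemma s_le:
  assumes "z \<in> K" shows "s k z \<le> 4 * M"
proof -
  have "1 * s k z \<le> sqrt 2 ^ k * s k z"
    using s_nonneg[OF assms] by (intro mult_right_mono one_le_power) auto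
  also have "\<dots> \<le> cost k z (near k z)" using pen_nonneg[OF near(1)[OF assms]] by (simp add: cost_def)
  also have "\<dots> \<le> 3 * M + M / 2 ^ k" using near(2)[OF assms, of k] opt_upper[OF assms, of k] by simp
  also have "M / 2 ^ k \<le> M / 1" using M_pos by (intro divide_left_mono) auto
  finally show ?thesis by simp
qed

lemma p_nonneg: "z \<in> K \<Longrightarrow> 0 \<le> p k z"
  using \<phi>_nonneg near(1) by simp

lemma p_le:
  assumes "z \<in> K" shows "p k z \<le> M"
proof -
  have "1 * (p k z)\<^sup>2 \<le> 2 ^ k * (p k z)\<^sup>2" by (intro mult_right_mono one_le_power) auto
  also have "\<dots> \<le> (\<Sum>j<Suc k. 2 ^ j * (\<phi> j (near k z))\<^sup>2)"
    by (rule member_le_sum) auto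
  also have "\<dots> \<le> M\<^sup>2" by (rule \<phi>_sum) (rule near(1)[OF assms])
  finally show ?thesis using M_pos by (intro power2_le_imp_le[of "p k z" M]) simp_all
qed

lemma sqrt_two_bounds: "4 / 3 \<le> sqrt 2" "sqrt 2 \<le> 3 / 2"
  by (rule real_le_rsqrt, simp add: power2_eq_square) (rule real_le_lsqrt, auto simp: power2_eq_square)

lemma pow_sqrt: "(sqrt 2 ^ k)\<^sup>2 = (2::real) ^ k"
  by (simp add: power2_eq_square flip: power_mult_distrib)

text \<open>
  Passing from \<open>n\<close> to \<open>n + 1\<close>, the cost of the point \<open>near (n + 1) z\<close> grows by its new penalty term and by
  \<open>(\<surd>2 - 1) 2\<^sup>n\<^sup>/\<^sup>2\<close> times its distance to \<open>z\<close>. Before the step it is at least \<open>opt n z\<close>, so these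
  quantities telescope against the bounded increasing sequence of minima.
\<close>

lemma sum_near:
  assumes z: "z \<in> K"
  shows "(\<Sum>k<Suc n. 2 ^ k * (p k z)\<^sup>2 / M + sqrt 2 ^ k * s k z / 4)
    \<le> opt n z + (\<Sum>k<Suc n. M / 2 ^ k)"
proof (induction n)
  case 0
  have "0 \<le> M * q (near 0 z)" using q_bounds[OF near(1)[OF z]] M_pos by simp
  moreover have "M * q (near 0 z) + (p 0 z)\<^sup>2 / M + s 0 z \<le> opt 0 z + M"
    using near(2)[OF z, of 0] by (simp add: cost_def pen_def)
  moreover have "0 \<le> s 0 z" by (rule s_nonneg[OF z])
  ultimately show ?case by simp
next
  case (Suc n)
  define y where "y = near (Suc n) z"
  have y: "y \<in> K" using near(1)[OF z] by (simp add: y_def)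
  have "cost (Suc n) z y = cost n z y + 2 ^ Suc n * (p (Suc n) z)\<^sup>2 / M
      + (sqrt 2 ^ Suc n - sqrt 2 ^ n) * s (Suc n) z"
    by (simp add: cost_def pen_def y_def add_divide_distrib algebra_simps)
  moreover have "sqrt 2 ^ Suc n / 4 * s (Suc n) z \<le> (sqrt 2 ^ Suc n - sqrt 2 ^ n) * s (Suc n) z"
  proof (rule mult_right_mono)
    have "1 * sqrt 2 ^ n \<le> (3 / 4 * sqrt 2) * sqrt 2 ^ n"
      using sqrt_two_bounds(1) by (intro mult_right_mono) auto
    then show "sqrt 2 ^ Suc n / 4 \<le> sqrt 2 ^ Suc n - sqrt 2 ^ n" by simp
  qed (rule s_nonneg[OF z])
  moreover have "cost (Suc n) z y \<le> opt (Suc n) z + M / 2 ^ Suc n"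
    unfolding y_def by (rule near(2)[OF z])
  moreover have "opt n z \<le> cost n z y" by (rule opt_le[OF z y])
  ultimately show ?case using Suc by (subst (1 2) sum.lessThan_Suc) simp
qed

lemma sum_p_s:
  assumes z: "z \<in> K"
  shows "(\<Sum>k<n. sqrt 2 ^ k * s k z) \<le> 20 * M" and "(\<Sum>k<n. 2 ^ k * (p k z)\<^sup>2 / M) \<le> 5 * M"
proof -
  have geo: "(\<Sum>k<n. M / 2 ^ k) + M * 2 / 2 ^ n = 2 * M" for n
    by (induction n) (auto simp: field_simps)
  have geo': "(\<Sum>k<n. M / 2 ^ k) \<le> 2 * M" for n
  proof -
    have "0 \<le> M * 2 / 2 ^ n" using M_pos by simp
    then show ?thesis using geo[of n] by linarith
  qed
  have P: "0 \<le> (\<Sum>k<n. 2 ^ k * (p k z)\<^sup>2 / M)" for n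
    using M_pos by (intro sum_nonneg) auto
  have Q: "0 \<le> (\<Sum>k<n. sqrt 2 ^ k * s k z / 4)" for n
    using s_nonneg[OF z] by (intro sum_nonneg) auto
  have tot: "(\<Sum>k<n. 2 ^ k * (p k z)\<^sup>2 / M) + (\<Sum>k<n. sqrt 2 ^ k * s k z / 4) \<le> 5 * M"
  proof (cases n)
    case (Suc n')
    have "(\<Sum>k<n. 2 ^ k * (p k z)\<^sup>2 / M) + (\<Sum>k<n. sqrt 2 ^ k * s k z / 4) \<le>
      opt n' z + (\<Sum>k<n. M / 2 ^ k)"
      using sum_near[OF z, of n'] unfolding Suc sum.distrib by simp
    also have "\<dots> \<le> 3 * M + 2 * M" by (intro add_mono opt_upper[OF z] geo')
    finally show ?thesis by simp
  qed (use M_pos in simp)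
  show "(\<Sum>k<n. 2 ^ k * (p k z)\<^sup>2 / M) \<le> 5 * M" using tot Q[of n] by linarith
  have "(\<Sum>k<n. sqrt 2 ^ k * s k z / 4) \<le> 5 * M" using tot P[of n] by linarith
  then show "(\<Sum>k<n. sqrt 2 ^ k * s k z) \<le> 20 * M" by (simp flip: sum_divide_distrib)
qed

lemma sum_\<phi>_le:
  assumes "y \<in> K"
  shows "(\<Sum>j<Suc k. 2 ^ j * \<phi> j y) \<le> 4 * 2 ^ k * \<phi> k y"
proof (induction k)
  case 0
  then show ?case using \<phi>_nonneg[OF assms, of 0] by simp
next
  case (Suc k)
  have "4 * 2 ^ k * \<phi> k y \<le> 4 * 2 ^ k * (3 / 2 * \<phi> (Suc k) y)"
    using \<phi>_regular[OF assms] by (intro mult_left_mono) auto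
  moreover have "(\<Sum>j<Suc (Suc k). 2 ^ j * \<phi> j y) = (\<Sum>j<Suc k. 2 ^ j * \<phi> j y) + 2 * 2 ^ k * \<phi> (Suc k) y"
    by (subst sum.lessThan_Suc) simp
  ultimately show ?case using Suc unfolding power_Suc by linarith
qed

text \<open>
  Each \<open>\<phi>\<^sub>j\<close> rises by at most \<open>4 \<theta>\<close>, so its square rises by \<open>8 \<theta> \<phi>\<^sub>j + 16 \<theta>\<^sup>2\<close>. With the weights \<open>2\<^sup>j\<close> the
  sum over \<open>j \<le> k\<close> is dominated by its last terms, by regularity of \<open>\<phi>\<close>.
\<close>

lemma pen_mid:
  assumes y: "y \<in> K" "y' \<in> K" and "\<phi> k y \<le> \<theta>" "\<rho> y y' \<le> 2 * \<theta>" "0 \<le> \<theta>"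
  shows "pen k (mid y y') \<le> pen k y + M * (q (mid y y') - q y) + 64 * 2 ^ k * \<theta>\<^sup>2 / M"
proof -
  have m: "mid y y' \<in> K" by (rule mid_in[OF y])
  have "(\<phi> j (mid y y'))\<^sup>2 \<le> (\<phi> j y)\<^sup>2 + 8 * \<theta> * \<phi> j y + 16 * \<theta>\<^sup>2" for j
  proof -
    have "\<phi> j (mid y y') \<le> \<phi> j y + 4 * \<theta>" using \<phi>_mid[OF y, of j] assms(4) by linarith
    then have "(\<phi> j (mid y y'))\<^sup>2 \<le> (\<phi> j y + 4 * \<theta>)\<^sup>2"
      using \<phi>_nonneg[OF m] by (intro power_mono) auto
    then show ?thesis by (simp add: power2_eq_square algebra_simps)
  qed
  then have "(\<Sum>j<Suc k. 2 ^ j * (\<phi> j (mid y y'))\<^sup>2)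
      \<le> (\<Sum>j<Suc k. 2 ^ j * ((\<phi> j y)\<^sup>2 + 8 * \<theta> * \<phi> j y + 16 * \<theta>\<^sup>2))"
    by (intro sum_mono mult_left_mono) auto
  also have "\<dots> = (\<Sum>j<Suc k. 2 ^ j * (\<phi> j y)\<^sup>2) + 8 * \<theta> * (\<Sum>j<Suc k. 2 ^ j * \<phi> j y)
      + 16 * \<theta>\<^sup>2 * (\<Sum>j<Suc k. 2 ^ j)"
    unfolding sum_distrib_left sum.distrib[symmetric] by (intro sum.cong refl) (simp add: algebra_simps)
  also have "\<dots> \<le> (\<Sum>j<Suc k. 2 ^ j * (\<phi> j y)\<^sup>2) + 8 * \<theta> * (4 * 2 ^ k * \<theta>) + 16 * \<theta>\<^sup>2 * (2 * 2 ^ k)"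
  proof (intro add_mono mult_left_mono order_refl)
    have "4 * 2 ^ k * \<phi> k y \<le> 4 * 2 ^ k * \<theta>" using assms(3) by (intro mult_left_mono) auto
    then show "(\<Sum>j<Suc k. 2 ^ j * \<phi> j y) \<le> 4 * 2 ^ k * \<theta>" using sum_\<phi>_le[OF y(1), of k] by linarith
    have "(\<Sum>j<n. (2::real) ^ j) = 2 ^ n - 1" for n by (induction n) auto
    then show "(\<Sum>j<Suc k. (2::real) ^ j) \<le> 2 * 2 ^ k" by (metis diff_le_eq le_add_same_cancel1 power_Suc zero_le_one)
  qed (use assms(5) in auto)
  also have "\<dots> = (\<Sum>j<Suc k. 2 ^ j * (\<phi> j y)\<^sup>2) + 64 * 2 ^ k * \<theta>\<^sup>2"
    by (simp add: power2_eq_square)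
  finally have "(\<Sum>j<Suc k. 2 ^ j * (\<phi> j (mid y y'))\<^sup>2)
      \<le> (\<Sum>j<Suc k. 2 ^ j * (\<phi> j y)\<^sup>2) + 64 * 2 ^ k * \<theta>\<^sup>2" .
  then have "(\<Sum>j<Suc k. 2 ^ j * (\<phi> j (mid y y'))\<^sup>2) / M
      \<le> ((\<Sum>j<Suc k. 2 ^ j * (\<phi> j y)\<^sup>2) + 64 * 2 ^ k * \<theta>\<^sup>2) / M"
    using M_pos by (intro divide_right_mono) auto
  then show ?thesis unfolding pen_def by (simp add: add_divide_distrib right_diff_distrib)
qed

lemma near_descent:
  assumes z: "z \<in> K" and y: "y' \<in> K" and "p k z \<le> \<theta>" "\<rho> (near k z) y' \<le> 2 * \<theta>" "0 \<le> \<theta>"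
  shows "M * (q (near k z) - q (mid (near k z) y'))
    \<le> sqrt 2 ^ k * d (near k z) y' + M / 2 ^ k + 64 * 2 ^ k * \<theta>\<^sup>2 / M"
proof -
  define y where "y = near k z"
  have yK: "y \<in> K" using near(1)[OF z] by (simp add: y_def)
  have m: "mid y y' \<in> K" by (rule mid_in[OF yK y])
  have "cost k z y \<le> cost k z (mid y y') + M / 2 ^ k"
    using near(2)[OF z, of k] opt_le[OF z m, of k] by (simp add: y_def)
  moreover have "sqrt 2 ^ k * d z (mid y y') \<le> sqrt 2 ^ k * (d z y + d y y')"
    using d_tri[OF z yK m] d_mid[OF yK y] by (intro mult_left_mono) auto
  moreover have "pen k (mid y y') \<le> pen k y + M * (q (mid y y') - q y) + 64 * 2 ^ k * \<theta>\<^sup>2 / M"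
    by (rule pen_mid) (use assms yK in \<open>auto simp: y_def\<close>)
  ultimately show ?thesis unfolding cost_def y_def[symmetric] by (simp add: algebra_simps)
qed

text \<open>
  Near minimality of both points is tested against their mean, whose squared norm is below the average by
  half of the squared distance of the points.
\<close>

lemma near_close:
  assumes z: "z \<in> K" "z' \<in> K" and "p k z \<le> \<theta>" "p k z' \<le> \<theta>" "\<rho> (near k z) (near k z') \<le> 2 * \<theta>"
  shows "(e (near k z) (near k z'))\<^sup>2
    \<le> 2 / M * (sqrt 2 ^ k * d (near k z) (near k z') + M / 2 ^ k) + 128 * 2 ^ k * \<theta>\<^sup>2 / M\<^sup>2"
proof -
  define y y' where "y = near k z" and "y' = near k z'"
  have y: "y \<in> K" "y' \<in> K" using near(1) z by (simp_all add: y_def y'_def)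
  have \<theta>: "0 \<le> \<theta>" using p_nonneg[OF z(1), of k] assms(3) by linarith
  define E where "E = sqrt 2 ^ k * d y y' + M / 2 ^ k + 64 * 2 ^ k * \<theta>\<^sup>2 / M"
  have "M * (q y - q (mid y y')) \<le> E"
    unfolding E_def y_def by (rule near_descent[OF z(1)]) (use assms \<theta> y in \<open>auto simp: y'_def\<close>)
  moreover have "M * (q y' - q (mid y' y)) \<le> sqrt 2 ^ k * d y' y + M / 2 ^ k + 64 * 2 ^ k * \<theta>\<^sup>2 / M"
    unfolding y'_def
    by (rule near_descent[OF z(2)]) (use assms \<theta> y \<rho>_sym[OF y] in \<open>auto simp: y'_def y_def\<close>)
  then have "M * (q y' - q (mid y y')) \<le> E"
    using d_sym[OF y] mid_sym[of y y'] by (simp add: E_def)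
  ultimately have "M * (q y + q y' - 2 * q (mid y y')) \<le> 2 * E" by (simp add: algebra_simps)
  then have "M * (e y y')\<^sup>2 \<le> 2 * E" using q_mid[OF y] by simp
  then have "(e y y')\<^sup>2 \<le> 2 * E / M" using M_pos by (simp add: pos_le_divide_eq mult.commute)
  also have "\<dots> = 2 / M * (sqrt 2 ^ k * d y y' + M / 2 ^ k) + 128 * 2 ^ k * \<theta>\<^sup>2 / M\<^sup>2"
    using M_pos by (simp add: E_def power2_eq_square field_simps)
  finally show ?thesis by (simp add: y_def y'_def)
qed

text \<open>
  The error of one splitting step; the constants are those produced by the lemma \<open>cover_arith\<close>.
\<close>

definition t :: "nat \<Rightarrow> 'a \<Rightarrow> real" where
  "t k z = 3 * s k z + 1168 * (sqrt 2 ^ k * (p k z)\<^sup>2 / M) + 4678 * (M / 2 ^ k)"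

lemma sum_t:
  assumes z: "z \<in> K"
  shows "(\<Sum>k<n. sqrt 2 ^ k * t k z) \<le> 25000 * M"
proof -
  have geo: "(\<Sum>k<n. (1 / sqrt 2) ^ k) \<le> 4" for n
  proof -
    have "1 / sqrt 2 \<le> 3 / 4" using sqrt_two_bounds(1) by (simp add: field_simps)
    then have "(\<Sum>k<n. (1 / sqrt 2) ^ k) \<le> (\<Sum>k<n. (3 / 4) ^ k)"
      by (intro sum_mono power_mono) auto
    also have "\<dots> = 4 - 4 * (3 / 4) ^ n" by (induction n) auto
    also have "\<dots> \<le> 4" by simp
    finally show ?thesis .
  qed
  have "sqrt 2 ^ k * t k z = 3 * (sqrt 2 ^ k * s k z) + 1168 * (2 ^ k * (p k z)\<^sup>2 / M)
      + 4678 * M * (1 / sqrt 2) ^ k" for k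
  proof -
    define g where "g = sqrt 2 ^ k"
    have g: "0 < g" "(2::real) ^ k = g * g" "(1 / sqrt 2) ^ k = 1 / g"
      using pow_sqrt[of k] by (auto simp: g_def power2_eq_square power_divide)
    show ?thesis unfolding t_def g_def[symmetric] g(2,3) using g(1) by (simp add: field_simps)
  qed
  then have "(\<Sum>k<n. sqrt 2 ^ k * t k z) = 3 * (\<Sum>k<n. sqrt 2 ^ k * s k z)
      + 1168 * (\<Sum>k<n. 2 ^ k * (p k z)\<^sup>2 / M) + 4678 * M * (\<Sum>k<n. (1 / sqrt 2) ^ k)"
    by (simp add: sum.distrib sum_distrib_left)
  also have "\<dots> \<le> 3 * (20 * M) + 1168 * (5 * M) + 4678 * M * 4"
    using sum_p_s[OF z] geo M_pos by (intro add_mono mult_left_mono) auto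
  finally show ?thesis using M_pos by simp
qed

text \<open>
  This is where \<open>\<delta>\<close> is absorbed. As \<open>X\<^sup>2\<close> contains \<open>2 g \<delta> / M\<close>, the product \<open>12 \<theta> X\<close> is split by the
  arithmetic--geometric mean inequality with weight \<open>M / (16 g)\<close> on \<open>X\<^sup>2\<close>, which leaves \<open>\<delta> / 8\<close> and a multiple of
  \<open>g \<theta>\<^sup>2 / M\<close>. Here \<open>g\<close> stands for \<open>2\<^sup>k\<^sup>/\<^sup>2\<close>.
\<close>

lemma cover_arith:
  assumes g: "1 \<le> g" and M: "0 < M" and X: "X\<^sup>2 = 2 / M * (g * (\<delta> + 2 * \<sigma>) + M / g\<^sup>2) + 128 * g\<^sup>2 * \<theta>\<^sup>2 / M\<^sup>2"
    and \<sigma>: "\<sigma> \<le> s' + 2 * (M / g\<^sup>2)" and \<theta>: "0 \<le> \<theta>" "\<theta> \<le> p' + 2 * (M / g\<^sup>2)" and "0 \<le> s'"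
  shows "2 * \<sigma> + 12 * \<theta> * X \<le> \<delta> / 8 + (3 * s' + 1168 * (g * p'\<^sup>2 / M) + 4678 * (M / g\<^sup>2))"
proof -
  define \<mu> where "\<mu> = M / g\<^sup>2"
  have g0: "0 < g" using g by simp
  have \<mu>0: "0 < \<mu>" using M g0 by (simp add: \<mu>_def)
  have "0 \<le> (M * X - 96 * g * \<theta>)\<^sup>2 / (16 * g * M)" using g0 M by simp
  also have "\<dots> = M / (16 * g) * X\<^sup>2 + 576 * (g * \<theta>\<^sup>2 / M) - 12 * \<theta> * X"
    using g0 M by (simp add: field_simps power2_eq_square)
  also have "M / (16 * g) * X\<^sup>2 = \<delta> / 8 + \<sigma> / 4 + \<mu> / (8 * g) + 8 * (g * \<theta>\<^sup>2 / M)"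
    unfolding X \<mu>_def using g0 M by (simp add: field_simps power2_eq_square)
  finally have a: "12 * \<theta> * X \<le> \<delta> / 8 + \<sigma> / 4 + \<mu> / (8 * g) + 584 * (g * \<theta>\<^sup>2 / M)"
    by (simp only: le_diff_eq) simp
  have "\<mu> / (8 * g) \<le> \<mu> / 8" using g \<mu>0 by (intro divide_left_mono) auto
  moreover have "g * \<theta>\<^sup>2 / M \<le> 2 * (g * p'\<^sup>2 / M) + 8 * \<mu>"
  proof -
    have "\<theta>\<^sup>2 \<le> (p' + 2 * \<mu>)\<^sup>2" using \<theta> by (intro power_mono) (auto simp: \<mu>_def)
    also have "\<dots> \<le> 2 * p'\<^sup>2 + 8 * \<mu>\<^sup>2"
      using zero_le_power2[of "p' - 2 * \<mu>"] by (simp add: power2_eq_square algebra_simps)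
    finally have "g * \<theta>\<^sup>2 / M \<le> g * (2 * p'\<^sup>2 + 8 * \<mu>\<^sup>2) / M"
      using g0 M by (intro divide_right_mono mult_left_mono) auto
    also have "\<dots> = 2 * (g * p'\<^sup>2 / M) + 8 * (\<mu> * (1 / g))"
      using g0 M by (simp add: \<mu>_def field_simps power2_eq_square)
    also have "\<dots> \<le> 2 * (g * p'\<^sup>2 / M) + 8 * (\<mu> * 1)"
      using g g0 \<mu>0 by (intro add_left_mono mult_left_mono) auto
    finally show ?thesis by simp
  qed
  moreover define Y Y' Z W where "Y = g * \<theta>\<^sup>2 / M" and "Y' = g * p'\<^sup>2 / M"
    and "Z = 12 * \<theta> * X" and "W = \<mu> / (8 * g)"
  ultimately show ?thesis using a \<sigma> \<open>0 \<le> s'\<close> \<mu>0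
    unfolding \<mu>_def[symmetric] Y_def[symmetric] Y'_def[symmetric] Z_def[symmetric] W_def[symmetric]
    by linarith
qed

text \<open>
  Four colourings are superposed: by the net cell of \<open>near k z\<close>, by the rounded values of its distance to
  \<open>z\<close> and of its \<open>\<phi>\<^sub>k\<close>, and finally by a cover of the points \<open>near k z\<close> that remain. After the
  first three, all bounds needed for the last one are uniform over a class up to \<open>\<mu>\<close>. The exponents of
  the four numbers of colours sum up to at most \<open>11 * 2\<^sup>k\<close>, whence \<open>\<tau> = 4\<close>.
\<close>

lemma splits_step:
  assumes B: "B \<subseteq> K" and \<delta>: "\<And>x y. x \<in> B \<Longrightarrow> y \<in> B \<Longrightarrow> d x y \<le> \<delta>"
  shows "splits B (2 ^ (2 ^ 4 * 2 ^ k)) (\<lambda>x y. d x y \<le> \<delta> / 8 + t k x)"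
proof -
  define \<mu> where "\<mu> = M / 2 ^ k"
  have \<mu>: "0 < \<mu>" using M_pos by (simp add: \<mu>_def)
  have fine: "splits B' (2 ^ (5 * 2 ^ k)) (\<lambda>x y. d x y \<le> \<delta> / 8 + t k x)"
    if B': "B' \<subseteq> B"
      and r: "\<And>x y. x \<in> B' \<Longrightarrow> y \<in> B' \<Longrightarrow> \<rho> (near k x) (near k y) \<le> p k x + p k y"
      and ss: "\<And>x y. x \<in> B' \<Longrightarrow> y \<in> B' \<Longrightarrow> \<bar>s k x - s k y\<bar> \<le> \<mu>"
      and pp: "\<And>x y. x \<in> B' \<Longrightarrow> y \<in> B' \<Longrightarrow> \<bar>p k x - p k y\<bar> \<le> \<mu>" for B'
  proof (cases "B' = {}")
    case True
    then show ?thesis by (simp add: splits_def)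
  next
    case False
    then obtain z0 where z0: "z0 \<in> B'" by auto
    define \<sigma> \<theta> where "\<sigma> = s k z0 + \<mu>" and "\<theta> = p k z0 + \<mu>"
    have K: "x \<in> K" if "x \<in> B'" for x using that B B' by auto
    have \<theta>: "p k x \<le> \<theta>" "\<theta> \<le> p k x + 2 * \<mu>" and \<sigma>: "s k x \<le> \<sigma>" "\<sigma> \<le> s k x + 2 * \<mu>"
      if "x \<in> B'" for x
      using ss[OF that z0] pp[OF that z0] by (auto simp: \<sigma>_def \<theta>_def)
    have \<theta>0: "0 \<le> \<theta>" using p_nonneg[OF K[OF z0], of k] \<mu> by (simp add: \<theta>_def)
    have d_near: "d (near k x) (near k y) \<le> \<delta> + 2 * \<sigma>" if xy: "x \<in> B'" "y \<in> B'" for x y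
    proof -
      note xK = K[OF xy(1)] near(1)[OF K[OF xy(1)], of k] and yK = K[OF xy(2)] near(1)[OF K[OF xy(2)], of k]
      have "d (near k x) (near k y) \<le> d (near k x) x + (d x y + d y (near k y))"
        using d_tri[OF xK(2,1) yK(2)] d_tri[OF xK(1) yK] by linarith
      then show ?thesis
        using d_sym[OF xK(2,1)] \<delta>[of x y] \<sigma>(1)[OF xy(1)] \<sigma>(1)[OF xy(2)] xy B' by force
    qed
    have r2: "\<rho> (near k x) (near k y) \<le> 2 * \<theta>" if "x \<in> B'" "y \<in> B'" for x y
      using r[OF that] \<theta>(1)[OF that(1)] \<theta>(1)[OF that(2)] by linarith
    define X2 where "X2 = 2 / M * (sqrt 2 ^ k * (\<delta> + 2 * \<sigma>) + \<mu>) + 128 * 2 ^ k * \<theta>\<^sup>2 / M\<^sup>2"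
    define X where "X = sqrt X2"
    have e_near: "(e (near k x) (near k y))\<^sup>2 \<le> X2" if xy: "x \<in> B'" "y \<in> B'" for x y
    proof -
      have "(e (near k x) (near k y))\<^sup>2
        \<le> 2 / M * (sqrt 2 ^ k * d (near k x) (near k y) + \<mu>) + 128 * 2 ^ k * \<theta>\<^sup>2 / M\<^sup>2"
        unfolding \<mu>_def by (rule near_close) (use K \<theta> r2 xy in auto)
      also have "\<dots> \<le> X2"
        unfolding X2_def using d_near[OF xy] M_pos
        by (intro add_mono mult_left_mono order_refl) auto
      finally show ?thesis .
    qed
    have X2: "0 \<le> X2" using e_near[OF z0 z0] by (meson order_trans zero_le_power2)
    have "splits (near k ` B') (2 ^ (5 * 2 ^ k)) (\<lambda>x y. d x y \<le> 12 * \<theta> * X)"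
    proof (rule d_cover)
      show "near k ` B' \<subseteq> K" using near(1) K by auto
      fix x y assume "x \<in> near k ` B'" "y \<in> near k ` B'"
      then show "\<rho> x y \<le> 2 * \<theta>" using r2 by auto
      from \<open>x \<in> near k ` B'\<close> \<open>y \<in> near k ` B'\<close> have "(e x y)\<^sup>2 \<le> X2" using e_near by auto
      then show "e x y \<le> X" unfolding X_def by (rule real_le_rsqrt)
    qed (use \<theta> in auto)
    then have "splits B' (2 ^ (5 * 2 ^ k)) (\<lambda>x y. d (near k x) (near k y) \<le> 12 * \<theta> * X)"
      by (rule splits_vimage)
    then show ?thesis
    proof (rule splits_mono)
      fix x y assume xy: "x \<in> B'" "y \<in> B'" and dxy: "d (near k x) (near k y) \<le> 12 * \<theta> * X"
      note xK = K[OF xy(1)] near(1)[OF K[OF xy(1)], of k] and yK = K[OF xy(2)] near(1)[OF K[OF xy(2)], of k]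
      have "d x y \<le> d x (near k x) + (d (near k x) (near k y) + d (near k y) y)"
        using d_tri[OF xK yK(1)] d_tri[OF xK(2) yK(2,1)] by linarith
      then have "d x y \<le> 2 * \<sigma> + 12 * \<theta> * X"
        using d_sym[OF yK] \<sigma>(1)[OF xy(1)] \<sigma>(1)[OF xy(2)] dxy by linarith
      also have "\<dots> \<le> \<delta> / 8 + (3 * s k x + 1168 * (sqrt 2 ^ k * (p k x)\<^sup>2 / M) + 4678 * (M / (sqrt 2 ^ k)\<^sup>2))"
      proof (rule cover_arith)
        show "1 \<le> sqrt 2 ^ k" by (rule one_le_power) simp
        show "X\<^sup>2 = 2 / M * (sqrt 2 ^ k * (\<delta> + 2 * \<sigma>) + M / (sqrt 2 ^ k)\<^sup>2) + 128 * (sqrt 2 ^ k)\<^sup>2 * \<theta>\<^sup>2 / M\<^sup>2"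
          using X2 by (simp add: X_def X2_def \<mu>_def pow_sqrt)
        show "\<sigma> \<le> s k x + 2 * (M / (sqrt 2 ^ k)\<^sup>2)" "\<theta> \<le> p k x + 2 * (M / (sqrt 2 ^ k)\<^sup>2)"
          using \<sigma>(2)[OF xy(1)] \<theta>(2)[OF xy(1)] by (simp_all add: \<mu>_def pow_sqrt)
      qed (use M_pos \<theta>0 s_nonneg[OF xK(1)] in auto)
      finally show "d x y \<le> \<delta> / 8 + t k x" by (simp add: t_def pow_sqrt)
    qed simp
  qed
  have c1: "splits B (2 ^ 2 ^ k) (\<lambda>x y. \<rho> (near k x) (near k y) \<le> p k x + p k y)"
  proof (rule splits_vimage)
    have "near k ` B \<subseteq> K" using near(1) B by auto
    then show "splits (near k ` B) (2 ^ 2 ^ k) (\<lambda>x y. \<rho> x y \<le> \<phi> k x + \<phi> k y)"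
      using \<phi>_net[of k] unfolding splits_def by blast
  qed
  have "splits B (2 ^ 2 ^ k * (Suc (4 * 2 ^ k) * (Suc (2 ^ k) * 2 ^ (5 * 2 ^ k))))
      (\<lambda>x y. d x y \<le> \<delta> / 8 + t k x)"
  proof (rule splits_trans[OF c1])
    fix B1 assume B1: "B1 \<subseteq> B"
      "\<And>x y. x \<in> B1 \<Longrightarrow> y \<in> B1 \<Longrightarrow> \<rho> (near k x) (near k y) \<le> p k x + p k y"
    have c2: "splits B1 (Suc (4 * 2 ^ k)) (\<lambda>x y. \<bar>s k x - s k y\<bar> \<le> \<mu>)"
      by (rule splits_real[OF _ \<mu>]) (use B1(1) B s_nonneg s_le in \<open>auto simp: \<mu>_def\<close>)
    show "splits B1 (Suc (4 * 2 ^ k) * (Suc (2 ^ k) * 2 ^ (5 * 2 ^ k))) (\<lambda>x y. d x y \<le> \<delta> / 8 + t k x)"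
    proof (rule splits_trans[OF c2])
      fix B2 assume B2: "B2 \<subseteq> B1" "\<And>x y. x \<in> B2 \<Longrightarrow> y \<in> B2 \<Longrightarrow> \<bar>s k x - s k y\<bar> \<le> \<mu>"
      have B2K: "x \<in> K" if "x \<in> B2" for x using that B2(1) B1(1) B by blast
      have c3: "splits B2 (Suc (2 ^ k)) (\<lambda>x y. \<bar>p k x - p k y\<bar> \<le> \<mu>)"
        by (rule splits_real[OF _ \<mu>]) (use B2K p_nonneg p_le in \<open>simp add: \<mu>_def\<close>)
      show "splits B2 (Suc (2 ^ k) * 2 ^ (5 * 2 ^ k)) (\<lambda>x y. d x y \<le> \<delta> / 8 + t k x)"
      proof (rule splits_trans[OF c3])
        fix B3 assume B3: "B3 \<subseteq> B2" "\<And>x y. x \<in> B3 \<Longrightarrow> y \<in> B3 \<Longrightarrow> \<bar>p k x - p k y\<bar> \<le> \<mu>"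
        show "splits B3 (2 ^ (5 * 2 ^ k)) (\<lambda>x y. d x y \<le> \<delta> / 8 + t k x)"
        proof (rule fine)
          show "B3 \<subseteq> B" using B1(1) B2(1) B3(1) by blast
        next
          fix x y assume xy: "x \<in> B3" "y \<in> B3"
          then have "x \<in> B2" "y \<in> B2" "x \<in> B1" "y \<in> B1" using B2(1) B3(1) by auto
          then show "\<rho> (near k x) (near k y) \<le> p k x + p k y" "\<bar>s k x - s k y\<bar> \<le> \<mu>"
            "\<bar>p k x - p k y\<bar> \<le> \<mu>"
            using B1(2) B2(2) B3(2) xy by auto
        qed
      qed
    qed
  qed
  then show ?thesis
  proof (rule splits_mono)
    have k: "Suc k \<le> 2 ^ k" by (simp add: Suc_leI)
    have k1: "1 \<le> (2::nat) ^ k" by simp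
    have "Suc (4 * 2 ^ k) \<le> (2::nat) ^ (k + 3)" using k1 by (simp add: power_add)
    also have "\<dots> \<le> 2 ^ (4 * 2 ^ k)" using k k1 by (intro power_increasing) auto
    finally have a: "Suc (4 * 2 ^ k) \<le> (2::nat) ^ (4 * 2 ^ k)" .
    have "Suc (2 ^ k) \<le> (2::nat) ^ (k + 1)" using k1 by simp
    also have "\<dots> \<le> 2 ^ 2 ^ k" using k by (intro power_increasing) auto
    finally have b: "Suc (2 ^ k) \<le> (2::nat) ^ 2 ^ k" .
    have "2 ^ 2 ^ k * (Suc (4 * 2 ^ k) * (Suc (2 ^ k) * 2 ^ (5 * 2 ^ k)))
        \<le> (2::nat) ^ 2 ^ k * (2 ^ (4 * 2 ^ k) * (2 ^ 2 ^ k * 2 ^ (5 * 2 ^ k)))"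
      using a b by (intro mult_mono) auto
    also have "\<dots> = 2 ^ (2 ^ k + (4 * 2 ^ k + (2 ^ k + 5 * 2 ^ k)))" by (simp only: power_add)
    also have "\<dots> \<le> 2 ^ (2 ^ 4 * 2 ^ k)" by (intro power_increasing) auto
    finally show "2 ^ 2 ^ k * (Suc (4 * 2 ^ k) * (Suc (2 ^ k) * 2 ^ (5 * 2 ^ k)))
        \<le> (2::nat) ^ (2 ^ 4 * 2 ^ k)" .
  qed
qed

theorem gamma2_le:
  assumes "K \<noteq> {}" and D: "\<And>x y. x \<in> K \<Longrightarrow> y \<in> K \<Longrightarrow> d x y \<le> D"
  shows "gamma2 K d \<le> ennreal (2 ^ 4 * ((real 4 + 2) * D + 6 * (25000 * M)))"
proof -
  have "0 \<le> 25000 * M" using M_pos by simp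
  from gamma2_le_of_splits[OF assms(1) d_nonneg d_sym d_tri D splits_step sum_t this]
  show ?thesis .
qed

end

section \<open>Regularising a summable sequence\<close>

text \<open>
  The least majorant of \<open>f\<close> that decays by at most the factor \<open>2 / 3\<close> per step. The factor has to exceed
  \<open>1 / 2\<close> for \<open>\<Sum>\<^sub>j\<^sub>\<le>\<^sub>k 2\<^sup>j f\<^sub>j\<close> to be of order \<open>2\<^sup>k f\<^sub>k\<close>, and to lie below \<open>1 / \<surd>2\<close> for the sum of
  \<open>2\<^sup>k f\<^sub>k\<^sup>2\<close> to survive.
\<close>

fun regularize :: "(nat \<Rightarrow> real) \<Rightarrow> nat \<Rightarrow> real" where
  "regularize f 0 = f 0"
| "regularize f (Suc k) = max (f (Suc k)) (2 / 3 * regularize f k)"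

lemma regularize_ge: "f k \<le> regularize f k"
  by (cases k) auto

lemma regularize_nonneg: "(\<And>k. 0 \<le> f k) \<Longrightarrow> 0 \<le> regularize f k"
  using regularize_ge order_trans by blast

lemma regularize_step: "regularize f k \<le> 3 / 2 * regularize f (Suc k)"
  using max.cobounded2[of "2 / 3 * regularize f k" "f (Suc k)"] unfolding regularize.simps by linarith

lemma regularize_lipschitz:
  assumes "\<And>k. f k \<le> g k + \<Delta>" "0 \<le> \<Delta>"
  shows "regularize f k \<le> regularize g k + \<Delta>"
proof (induction k)
  case (Suc k)
  have "2 / 3 * regularize f k \<le> 2 / 3 * regularize g k + \<Delta>" using Suc assms(2) by linarith
  then show ?case using assms(1)[of "Suc k"] by (auto simp: max_def)
qed (use assms in simp)

lemma sum_regularize: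
  assumes "\<And>k. 0 \<le> f k"
  shows "(\<Sum>k<n. 2 ^ k * (regularize f k)\<^sup>2) \<le> 9 * (\<Sum>k<n. 2 ^ k * (f k)\<^sup>2)"
proof -
  (* The last term is carried along: 4/9 of its square is inherited by the next one, whose weight
     doubles, and 9 * 2 * 4/9 = 8. *)
  have main: "(\<Sum>k<Suc n. 2 ^ k * (regularize f k)\<^sup>2) + 8 * (2 ^ n * (regularize f n)\<^sup>2)
      \<le> 9 * (\<Sum>k<Suc n. 2 ^ k * (f k)\<^sup>2)" for n
  proof (induction n)
    case (Suc n)
    define r where "r = regularize f n"
    have r0: "0 \<le> r" unfolding r_def by (rule regularize_nonneg[OF assms])
    have "(regularize f (Suc n))\<^sup>2 \<le> (f (Suc n))\<^sup>2 + 4 / 9 * r\<^sup>2"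
      by (auto simp: max_def r_def power_mult_distrib power2_eq_square)
    then have "9 * (2 * 2 ^ n * (regularize f (Suc n))\<^sup>2) \<le> 9 * (2 * 2 ^ n * ((f (Suc n))\<^sup>2 + 4 / 9 * r\<^sup>2))"
      by (intro mult_left_mono) auto
    also have "\<dots> = 9 * (2 ^ Suc n * (f (Suc n))\<^sup>2) + 8 * (2 ^ n * r\<^sup>2)" by (simp add: algebra_simps)
    finally have "9 * (2 ^ Suc n * (regularize f (Suc n))\<^sup>2)
      \<le> 9 * (2 ^ Suc n * (f (Suc n))\<^sup>2) + 8 * (2 ^ n * (regularize f n)\<^sup>2)" by (simp add: r_def)
    then show ?case using Suc unfolding sum.lessThan_Suc[of _ "Suc n"] distrib_left by linarith
  qed simp
  show ?thesis
  proof (cases n)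
    case (Suc n')
    have "0 \<le> 8 * (2 ^ n' * (regularize f n')\<^sup>2)" by simp
    then show ?thesis unfolding Suc using main[of n'] by linarith
  qed simp
qed

section \<open>Nets from the functional \<open>\<gamma>\<^sub>2\<^sub>,\<^sub>2\<close>\<close>

lemma cell_partition:
  assumes "partition_on T P" "x \<in> T"
  shows "cell P x \<in> P \<and> x \<in> cell P x"
proof -
  have "\<exists>!S. S \<in> P \<and> x \<in> S"
  proof (rule ex_ex1I)
    show "\<exists>S. S \<in> P \<and> x \<in> S" using assms partition_onD1 by blast
    show "S = S'" if "S \<in> P \<and> x \<in> S" "S' \<in> P \<and> x \<in> S'" for S S'
      using assms(1) that by (metis disjnt_iff pairwiseD partition_onD2)
  qed
  then show ?thesis unfolding cell_def by (rule theI')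
qed

lemma ennreal_sqrt_less:
  assumes "ennreal_sqrt x < ennreal b"
  shows "x \<le> ennreal (b\<^sup>2)"
proof -
  have "x \<noteq> \<infinity>" using assms by (auto simp: ennreal_sqrt_def)
  then obtain r where r: "x = ennreal r" "0 \<le> r" by (cases x) auto
  then have "ennreal (sqrt r) < ennreal b" using assms by (simp add: ennreal_sqrt_def)
  then have "sqrt r < b" by (meson ennreal_leI not_less)
  then have "r \<le> b\<^sup>2" by (simp add: sqrt_le_D)
  then show ?thesis using r by (simp add: ennreal_leI)
qed

text \<open>
  Choosing one point in every cell turns a nearly optimal admissible sequence into nets. The nets are
  handed on, and not the cells, since the distance to a net is Lipschitz, whereas the diameter of the cell
  of a point need not be.
\<close>

lemma gamma22_nets:
  assumes less: "gamma22 T \<delta> < ennreal b" and ne: "T \<noteq> {}"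
    and \<delta>: "\<And>x y. x \<in> T \<Longrightarrow> y \<in> T \<Longrightarrow> 0 \<le> \<delta> x y"
  obtains c :: "nat \<Rightarrow> 'a \<Rightarrow> 'a" where
    "\<And>k x. x \<in> T \<Longrightarrow> c k x \<in> T" "\<And>k. finite (c k ` T) \<and> card (c k ` T) \<le> 2 ^ 2 ^ k"
    "\<And>x y. x \<in> T \<Longrightarrow> y \<in> T \<Longrightarrow> c 0 x = c 0 y"
    "\<And>x n. x \<in> T \<Longrightarrow> (\<Sum>k<n. 2 ^ k * (\<delta> x (c k x))\<^sup>2) \<le> b\<^sup>2"
proof -
  obtain \<A> where adm: "admissible T \<A>"
    and lt: "(SUP x\<in>T. ennreal_sqrt (\<Sum>k. 2 ^ k * (pdiam \<delta> (cell (\<A> k) x))\<^sup>2)) < ennreal b"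
    using less unfolding gamma22_def by (auto simp: INF_less_iff)
  define c where "c k x = (SOME y. y \<in> cell (\<A> k) x)" for k x
  have part: "partition_on T (\<A> k)" for k using adm by (simp add: admissible_def)
  have cell: "cell (\<A> k) x \<in> \<A> k \<and> x \<in> cell (\<A> k) x" if "x \<in> T" for k x
    by (rule cell_partition[OF part that])
  have c_cell: "c k x \<in> cell (\<A> k) x" if "x \<in> T" for k x
    unfolding c_def using cell[OF that] by (metis someI)
  have c_in: "c k x \<in> T" if "x \<in> T" for k x
    using c_cell[OF that] cell[OF that] partition_onD1[OF part] by blast
  show ?thesis
  proof (rule that[of c])
    fix k
    have fin: "finite (\<A> k)" "card (\<A> k) \<le> 2 ^ 2 ^ k" using adm by (auto simp: admissible_def)
    have sub: "c k ` T \<subseteq> (\<lambda>S. SOME y. y \<in> S) ` \<A> k" unfolding c_def using cell by auto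
    show "finite (c k ` T) \<and> card (c k ` T) \<le> 2 ^ 2 ^ k"
      using finite_surj[OF fin(1) sub] surj_card_le[OF fin(1) sub] fin(2) by linarith
  next
    fix x y assume "x \<in> T" "y \<in> T"
    then have "cell (\<A> 0) x \<in> {T}" "cell (\<A> 0) y \<in> {T}"
      using cell[of x 0] cell[of y 0] adm by (auto simp: admissible_def)
    then show "c 0 x = c 0 y" by (simp add: c_def)
  next
    fix x n assume x: "x \<in> T"
    have "ennreal_sqrt (\<Sum>k. 2 ^ k * (pdiam \<delta> (cell (\<A> k) x))\<^sup>2) < ennreal b"
      using lt x by (meson SUP_upper le_less_trans)
    then have le: "(\<Sum>k. 2 ^ k * (pdiam \<delta> (cell (\<A> k) x))\<^sup>2) \<le> ennreal (b\<^sup>2)"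
      by (rule ennreal_sqrt_less)
    have pd: "ennreal (\<delta> x (c k x)) \<le> pdiam \<delta> (cell (\<A> k) x)" for k
      unfolding pdiam_def using cell[OF x] c_cell[OF x]
      by (intro SUP_upper2[of x] SUP_upper2[of "c k x"]) auto
    have "ennreal (\<Sum>k<n. 2 ^ k * (\<delta> x (c k x))\<^sup>2) = (\<Sum>k<n. ennreal (2 ^ k * (\<delta> x (c k x))\<^sup>2))"
      by (rule sum_ennreal[symmetric]) simp
    also have "\<dots> = (\<Sum>k<n. 2 ^ k * (ennreal (\<delta> x (c k x)))\<^sup>2)"
      using \<delta>[OF x c_in[OF x]] by (intro sum.cong refl) (simp add: ennreal_mult ennreal_power flip: ennreal_numeral)
    also have "\<dots> \<le> (\<Sum>k<n. 2 ^ k * (pdiam \<delta> (cell (\<A> k) x))\<^sup>2)"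
      using pd by (intro sum_mono mult_left_mono power_mono) auto
    also have "\<dots> \<le> (\<Sum>k. 2 ^ k * (pdiam \<delta> (cell (\<A> k) x))\<^sup>2)"
      by (rule sum_le_suminf) auto
    also have "\<dots> \<le> ennreal (b\<^sup>2)" by (rule le)
    finally show "(\<Sum>k<n. 2 ^ k * (\<delta> x (c k x))\<^sup>2) \<le> b\<^sup>2" by simp
  qed (rule c_in)
qed

section \<open>Euclidean norms and powers\<close>

lemma L2_diff_sym: "L2_set (\<lambda>x. f x - g x) A = L2_set (\<lambda>x. g x - f x) A"
  by (simp add: L2_set_def power2_commute)

lemma L2_diff_tri: "L2_set (\<lambda>x. f x - h x) A \<le> L2_set (\<lambda>x. f x - g x) A + L2_set (\<lambda>x. g x - h x) A"
  using L2_set_triangle_ineq[of "\<lambda>x. f x - g x" "\<lambda>x. g x - h x" A] by simp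

lemma L2_le_diff: "L2_set f A \<le> L2_set g A + L2_set (\<lambda>x. f x - g x) A"
  using L2_set_triangle_ineq[of g "\<lambda>x. f x - g x" A] by simp

lemma L2_mono_abs:
  assumes "\<And>x. x \<in> A \<Longrightarrow> \<bar>f x\<bar> \<le> \<bar>g x\<bar>"
  shows "L2_set f A \<le> L2_set g A"
  unfolding L2_set_def using assms by (intro real_sqrt_le_mono sum_mono) (simp add: abs_le_square_iff)

lemma L2_scale_le:
  assumes "\<And>x. x \<in> A \<Longrightarrow> \<bar>c x\<bar> \<le> b" "0 \<le> b"
  shows "L2_set (\<lambda>x. c x * f x) A \<le> b * L2_set f A"
proof -
  have "L2_set (\<lambda>x. c x * f x) A \<le> L2_set (\<lambda>x. b * f x) A"
    using assms by (intro L2_mono_abs) (auto simp: abs_mult intro!: mult_right_mono)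
  then show ?thesis using assms(2) by (simp add: L2_set_right_distrib)
qed

lemma L2_rows:
  assumes "finite A" "finite B"
  shows "L2_set (\<lambda>(i, j). c i j * h i) (A \<times> B) = L2_set (\<lambda>i. L2_set (c i) B * h i) A"
  unfolding L2_set_def using assms
  by (simp add: sum.cartesian_product' power_mult_distrib sum_nonneg sum_distrib_right)

lemma L2_columns:
  assumes "finite A" "finite B"
  shows "L2_set (\<lambda>(i, j). c i j * k j) (A \<times> B) = L2_set (\<lambda>j. L2_set (\<lambda>i. c i j) A * k j) B"
  unfolding L2_set_def using assms
  by (simp add: sum.cartesian_product' power_mult_distrib sum_nonneg sum_distrib_right sum.swap[of _ B A])

lemma rpow_nonneg: "0 \<le> rpow t a"
  by (simp add: rpow_def)

lemma rpow_mono: "0 \<le> t \<Longrightarrow> t \<le> s \<Longrightarrow> 0 \<le> a \<Longrightarrow> rpow t a \<le> rpow s a"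
  by (simp add: rpow_def powr_mono2)

lemma rpow_sqrt:
  assumes "0 \<le> x" "0 \<le> y"
  shows "rpow (sqrt (x * y)) a = sqrt (rpow x a * rpow y a)"
proof -
  have "sqrt (x * y) powr a = ((x * y) powr a) powr (1 / 2)"
    using assms by (simp add: powr_half_sqrt[symmetric] powr_powr mult.commute)
  also have "\<dots> = sqrt (x powr a * y powr a)" using assms by (simp add: powr_mult powr_half_sqrt real_sqrt_mult)
  finally show ?thesis by (simp add: rpow_def)
qed

lemma rpow_diff_le:
  assumes "0 \<le> t" "t \<le> s" "1 \<le> a"
  shows "rpow s a - rpow t a \<le> a * rpow s (a - 1) * (s - t)"
proof (cases "a = 1 \<or> t = s \<or> t = 0")
  case True
  have "s powr a = s powr (a - 1) * s" if "s \<noteq> 0"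
    using powr_add[of s "a - 1" 1] that assms by simp
  then have "s powr a \<le> a * (s powr (a - 1)) * s"
    using assms mult_right_mono[of 1 a "s powr (a - 1) * s"] by (cases "s = 0") (auto simp: mult.assoc)
  then show ?thesis using True assms by (auto simp: rpow_def)
next
  case False
  then have st: "0 < t" "t < s" "1 < a" using assms by auto
  have "\<exists>\<xi>. t < \<xi> \<and> \<xi> < s \<and> s powr a - t powr a = (s - t) * (a * \<xi> powr (a - 1))"
    using st by (intro MVT2) (auto intro!: derivative_eq_intros)
  then obtain \<xi> where \<xi>: "t < \<xi>" "\<xi> < s" "s powr a - t powr a = (s - t) * (a * \<xi> powr (a - 1))" by blast
  have "\<xi> powr (a - 1) \<le> s powr (a - 1)" using \<xi> st by (intro powr_mono2) auto
  then have "(s - t) * (a * \<xi> powr (a - 1)) \<le> (s - t) * (a * s powr (a - 1))"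
    using st by (intro mult_left_mono) auto
  then show ?thesis using \<xi>(3) st by (simp add: rpow_def mult.commute mult.left_commute)
qed

text \<open>
  If both coordinates move in the same direction, changing them one after the other passes through
  derivatives bounded by those at the larger point. If they move in opposite directions, the two changes have
  opposite signs, so each may be estimated on its own at the endpoint where its coordinate is larger.
\<close>

lemma monomial_increment:
  assumes "0 \<le> u" "0 \<le> u'" "0 \<le> v" "0 \<le> v'" "1 \<le> \<alpha>" "1 \<le> \<beta>"
  defines "A \<equiv> \<lambda>u v. \<alpha> * rpow u (\<alpha> - 1) * rpow v \<beta>" and "B \<equiv> \<lambda>u v. \<beta> * rpow u \<alpha> * rpow v (\<beta> - 1)"
  shows "\<bar>rpow u \<alpha> * rpow v \<beta> - rpow u' \<alpha> * rpow v' \<beta>\<bar>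
    \<le> max (A u v) (A u' v') * \<bar>u - u'\<bar> + max (B u v) (B u' v') * \<bar>v - v'\<bar>"
proof -
  have AB: "0 \<le> A u v" "0 \<le> B u v" if "0 \<le> u" "0 \<le> v" for u v
    using assms(5,6) by (auto simp: A_def B_def rpow_nonneg)
  have stepU: "0 \<le> (rpow u \<alpha> - rpow u' \<alpha>) * rpow v \<beta> \<and> (rpow u \<alpha> - rpow u' \<alpha>) * rpow v \<beta> \<le> A u v * (u - u')"
    if "0 \<le> u'" "u' \<le> u" for u u' v
  proof
    show "0 \<le> (rpow u \<alpha> - rpow u' \<alpha>) * rpow v \<beta>"
      using rpow_mono[OF that, of \<alpha>] assms(5) rpow_nonneg by (intro mult_nonneg_nonneg) auto
    have "(rpow u \<alpha> - rpow u' \<alpha>) * rpow v \<beta> \<le> (\<alpha> * rpow u (\<alpha> - 1) * (u - u')) * rpow v \<beta>"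
      by (intro mult_right_mono rpow_diff_le that assms rpow_nonneg)
    then show "(rpow u \<alpha> - rpow u' \<alpha>) * rpow v \<beta> \<le> A u v * (u - u')"
      by (simp add: A_def mult.assoc mult.left_commute mult.commute)
  qed
  have stepV: "0 \<le> rpow w \<alpha> * (rpow v \<beta> - rpow v' \<beta>) \<and> rpow w \<alpha> * (rpow v \<beta> - rpow v' \<beta>) \<le> B u v * (v - v')"
    if "0 \<le> v'" "v' \<le> v" "0 \<le> w" "w \<le> u" for u v v' w
  proof
    have d: "0 \<le> rpow v \<beta> - rpow v' \<beta>" using rpow_mono[OF that(1,2), of \<beta>] assms(6) by simp
    show "0 \<le> rpow w \<alpha> * (rpow v \<beta> - rpow v' \<beta>)"
      using d rpow_nonneg by (intro mult_nonneg_nonneg)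
    have "rpow w \<alpha> * (rpow v \<beta> - rpow v' \<beta>) \<le> rpow u \<alpha> * (\<beta> * rpow v (\<beta> - 1) * (v - v'))"
      by (intro mult_mono rpow_mono rpow_diff_le d rpow_nonneg that assms) (use assms(5) in simp)
    then show "rpow w \<alpha> * (rpow v \<beta> - rpow v' \<beta>) \<le> B u v * (v - v')"
      by (simp add: B_def mult.assoc mult.left_commute mult.commute)
  qed
  have main: "\<bar>rpow u \<alpha> * rpow v \<beta> - rpow u' \<alpha> * rpow v' \<beta>\<bar>
      \<le> max (A u v) (A u' v') * \<bar>u - u'\<bar> + max (B u v) (B u' v') * \<bar>v - v'\<bar>"
    if "0 \<le> u'" "u' \<le> u" "0 \<le> v" "0 \<le> v'" for u u' v v'
  proof -
    have split: "rpow u \<alpha> * rpow v \<beta> - rpow u' \<alpha> * rpow v' \<beta>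
      = (rpow u \<alpha> - rpow u' \<alpha>) * rpow v \<beta> + rpow u' \<alpha> * (rpow v \<beta> - rpow v' \<beta>)"
      by (simp add: algebra_simps)
    have a: "A u v * (u - u') \<le> max (A u v) (A u' v') * \<bar>u - u'\<bar>"
      using that by (intro mult_mono) (auto simp: AB le_max_iff_disj)
    have b: "B u v * (v - v') \<le> max (B u v) (B u' v') * \<bar>v - v'\<bar>" if "v' \<le> v"
      using that \<open>0 \<le> u'\<close> \<open>u' \<le> u\<close> \<open>0 \<le> v'\<close> by (intro mult_mono) (auto simp: AB le_max_iff_disj)
    have b': "B u' v' * (v' - v) \<le> max (B u v) (B u' v') * \<bar>v - v'\<bar>" if "v \<le> v'"
      using that \<open>0 \<le> u'\<close> \<open>0 \<le> v\<close> by (intro mult_mono) (auto simp: AB le_max_iff_disj)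
    show ?thesis
    proof (cases "v' \<le> v")
      case True
      show ?thesis using stepU[OF that(1,2), of v] stepV[OF that(4) True that(1,2)] a b[OF True]
        unfolding split by linarith
    next
      case False
      then have v: "v \<le> v'" by simp
      have "rpow u' \<alpha> * (rpow v \<beta> - rpow v' \<beta>) = - (rpow u' \<alpha> * (rpow v' \<beta> - rpow v \<beta>))"
        by (simp add: algebra_simps)
      then show ?thesis using stepU[OF that(1,2), of v] stepV[OF that(3) v that(1) order_refl] a b'[OF v]
        unfolding split by linarith
    qed
  qed
  show ?thesis
  proof (cases "u' \<le> u")
    case True
    then show ?thesis using main assms by blast
  next
    case False
    then show ?thesis using main[of u u' v' v] assms(1,3,4)
      by (simp add: abs_minus_commute max.commute)
  qed
qed

text \<open>
  The geometric mean of two numbers lies between them.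
\<close>

lemma abs_diff_sqrt_le:
  fixes x y :: real
  assumes "0 \<le> x" "0 \<le> y"
  shows "\<bar>x - sqrt (x * y)\<bar> \<le> \<bar>x - y\<bar>"
proof (cases "x \<le> y")
  case True
  have "x \<le> sqrt (x * y)" "sqrt (x * y) \<le> y"
    using assms True by (auto intro!: real_le_rsqrt real_le_lsqrt mult_mono simp: power2_eq_square)
  then show ?thesis by linarith
next
  case False
  then have "y \<le> x" by simp
  then have "y \<le> sqrt (x * y)" "sqrt (x * y) \<le> x"
    using assms by (auto intro!: real_le_rsqrt real_le_lsqrt mult_mono simp: power2_eq_square)
  then show ?thesis by linarith
qed

section \<open>The monomial map\<close>

locale monomial_map =
  fixes m n :: nat and \<alpha> \<beta> :: real and a :: rmat
  assumes m_pos: "0 < m" and n_pos: "0 < n" and \<alpha>: "1 \<le> \<alpha>" and \<beta>: "1 \<le> \<beta>"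
    and a_nonneg: "\<And>i j. i < m \<Longrightarrow> j < n \<Longrightarrow> 0 \<le> a i j"
begin

abbreviation K :: "(rvec \<times> rvec) set" where "K \<equiv> K_set m n"
abbreviation d :: "rvec \<times> rvec \<Rightarrow> rvec \<times> rvec \<Rightarrow> real" where "d \<equiv> d_dist m n \<alpha> \<beta> a"
abbreviation \<rho> :: "rvec \<times> rvec \<Rightarrow> rvec \<times> rvec \<Rightarrow> real" where "\<rho> \<equiv> rho_dist m n \<alpha> \<beta> a"
abbreviation F :: "rvec \<times> rvec \<Rightarrow> rmat" where "F \<equiv> F_map \<alpha> \<beta> a"
abbreviation U :: "rvec \<times> rvec \<Rightarrow> rmat" where "U \<equiv> U_map \<alpha> \<beta> a"
abbreviation V :: "rvec \<times> rvec \<Rightarrow> rmat" where "V \<equiv> V_map \<alpha> \<beta> a"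
abbreviation I :: "(nat + nat) set" where "I \<equiv> {..<m} <+> {..<n}"

definition coord :: "rvec \<times> rvec \<Rightarrow> nat + nat \<Rightarrow> real" where
  "coord z = case_sum (fst z) (snd z)"

text \<open>
  The semiaxes of the local ellipsoid.
\<close>

definition wt :: "rvec \<times> rvec \<Rightarrow> nat + nat \<Rightarrow> real" where
  "wt z = case_sum (\<lambda>i. L2_set (U z i) {..<n}) (\<lambda>j. L2_set (\<lambda>i. V z i j) {..<m})"

definition eucl :: "rvec \<times> rvec \<Rightarrow> rvec \<times> rvec \<Rightarrow> real" where
  "eucl z z' = L2_set (\<lambda>i. coord z i - coord z' i) I"

definition qform :: "rvec \<times> rvec \<Rightarrow> real" where
  "qform z = (\<Sum>i\<in>I. (coord z i)\<^sup>2)"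

text \<open>
  The arithmetic midpoint is of no use here: where \<open>u\<^sub>i\<close> and \<open>v\<^sub>j\<close> vanish at opposite endpoints, the
  monomial is zero at both of them but not in between.
\<close>

definition gmean :: "rvec \<times> rvec \<Rightarrow> rvec \<times> rvec \<Rightarrow> rvec \<times> rvec" where
  "gmean z z' = ((\<lambda>i. sqrt (fst z i * fst z' i)), (\<lambda>j. sqrt (snd z j * snd z' j)))"

lemma finite_I: "finite I"
  by simp

lemma sum_I: "(\<Sum>i\<in>I. f i) = (\<Sum>i<m. f (Inl i)) + (\<Sum>j<n. f (Inr j))"
  by (simp add: sum.Plus)

lemma wt_nonneg: "0 \<le> wt z i"
  by (cases i) (auto simp: wt_def)

lemma pos_ballD:
  assumes "x \<in> pos_ball k"
  shows "0 \<le> x i" and "(\<Sum>i<k. (x i)\<^sup>2) \<le> 1"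
proof -
  show "0 \<le> x i" using assms by (cases "i < k") (auto simp: pos_ball_def)
  have "L2_set x {..<k} \<le> 1" using assms by (simp add: pos_ball_def)
  then show "(\<Sum>i<k. (x i)\<^sup>2) \<le> 1" by (simp add: L2_set_def)
qed

lemma K_nonneg:
  assumes "z \<in> K"
  shows "0 \<le> fst z i" "0 \<le> snd z j"
  using assms pos_ballD by (auto simp: K_set_def)

lemma coord_nonneg: "z \<in> K \<Longrightarrow> 0 \<le> coord z i"
  using K_nonneg by (cases i) (auto simp: coord_def)

lemma qform_bounds:
  assumes "z \<in> K"
  shows "0 \<le> qform z \<and> qform z \<le> 2"
proof
  show "0 \<le> qform z" unfolding qform_def by (rule sum_nonneg) simp
  have "(\<Sum>i<m. (fst z i)\<^sup>2) \<le> 1" "(\<Sum>j<n. (snd z j)\<^sup>2) \<le> 1"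
    using assms pos_ballD(2) by (auto simp: K_set_def)
  then show "qform z \<le> 2" unfolding qform_def sum_I by (simp add: coord_def)
qed

lemma coord_gmean: "coord (gmean z z') i = sqrt (coord z i * coord z' i)"
  by (cases i) (auto simp: coord_def gmean_def)

lemma gmean_sym: "gmean z z' = gmean z' z"
  by (simp add: gmean_def mult.commute)

lemma gmean_pos_ball:
  assumes "x \<in> pos_ball k" "y \<in> pos_ball k"
  shows "(\<lambda>i. sqrt (x i * y i)) \<in> pos_ball k"
proof -
  have "(\<Sum>i<k. (sqrt (x i * y i))\<^sup>2) = (\<Sum>i<k. x i * y i)"
    using pos_ballD(1)[OF assms(1)] pos_ballD(1)[OF assms(2)] by simp
  also have "\<dots> \<le> (\<Sum>i<k. ((x i)\<^sup>2 + (y i)\<^sup>2) / 2)"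
  proof (rule sum_mono)
    fix i show "x i * y i \<le> ((x i)\<^sup>2 + (y i)\<^sup>2) / 2"
      using zero_le_power2[of "x i - y i"] by (simp add: power2_eq_square algebra_simps)
  qed
  also have "\<dots> = ((\<Sum>i<k. (x i)\<^sup>2) + (\<Sum>i<k. (y i)\<^sup>2)) / 2"
    by (simp add: sum.distrib add_divide_distrib sum_divide_distrib)
  also have "\<dots> \<le> 1" using pos_ballD(2)[OF assms(1)] pos_ballD(2)[OF assms(2)] by simp
  finally have "L2_set (\<lambda>i. sqrt (x i * y i)) {..<k} \<le> 1" by (simp add: L2_set_def)
  then show ?thesis
    using assms pos_ballD(1)[OF assms(1)] pos_ballD(1)[OF assms(2)] by (simp add: pos_ball_def)
qed

lemma gmean_in: "z \<in> K \<Longrightarrow> z' \<in> K \<Longrightarrow> gmean z z' \<in> K"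
  unfolding K_set_def gmean_def by (auto intro: gmean_pos_ball)

lemma qform_gmean:
  assumes "z \<in> K" "z' \<in> K"
  shows "2 * qform (gmean z z') = qform z + qform z' - (eucl z z')\<^sup>2"
proof -
  have "2 * qform (gmean z z') = (\<Sum>i\<in>I. 2 * (coord z i * coord z' i))"
    using coord_nonneg assms by (simp add: qform_def coord_gmean sum_distrib_left)
  also have "\<dots> = (\<Sum>i\<in>I. (coord z i)\<^sup>2 + (coord z' i)\<^sup>2 - (coord z i - coord z' i)\<^sup>2)"
    by (intro sum.cong refl) (simp add: power2_eq_square algebra_simps)
  also have "\<dots> = qform z + qform z' - (eucl z z')\<^sup>2"
    by (simp add: qform_def eucl_def L2_set_def sum.distrib sum_subtractf sum_nonneg)
  finally show ?thesis .
qed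

lemma eucl_nonneg: "0 \<le> eucl z z'"
  by (simp add: eucl_def)

lemma eucl_le:
  assumes "z \<in> K" "z' \<in> K"
  shows "eucl z z' \<le> 2"
proof -
  have "(eucl z z')\<^sup>2 \<le> 2\<^sup>2"
    using qform_gmean[OF assms] qform_bounds[OF gmean_in[OF assms]] qform_bounds[OF assms(1)]
      qform_bounds[OF assms(2)] by simp
  then show ?thesis by (rule power2_le_imp_le) simp
qed

lemma F_eq: "F z i j = a i j * rpow (fst z i) \<alpha> * rpow (snd z j) \<beta>"
  by (cases z) (simp add: F_map_def)

lemma U_eq: "U z i j = \<alpha> * a i j * rpow (fst z i) (\<alpha> - 1) * rpow (snd z j) \<beta>"
  by (cases z) (simp add: U_map_def)

lemma V_eq: "V z i j = \<beta> * a i j * rpow (fst z i) \<alpha> * rpow (snd z j) (\<beta> - 1)"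
  by (cases z) (simp add: V_map_def)

lemma maps_nonneg:
  assumes "i < m" "j < n"
  shows "0 \<le> F z i j" "0 \<le> U z i j" "0 \<le> V z i j"
  using a_nonneg[OF assms] \<alpha> \<beta> by (auto simp: F_eq U_eq V_eq rpow_nonneg)

lemma sqrt_mult_monomials:
  fixes c x y x' y' :: real
  assumes "0 \<le> c"
  shows "c * sqrt (x * x') * sqrt (y * y') = sqrt ((c * x * y) * (c * x' * y'))"
proof -
  have "(c * x * y) * (c * x' * y') = c\<^sup>2 * ((x * x') * (y * y'))"
    by (simp add: power2_eq_square algebra_simps)
  then show ?thesis using assms by (simp only: real_sqrt_mult real_sqrt_abs)
qed

lemma maps_gmean:
  assumes "z \<in> K" "z' \<in> K" "i < m" "j < n"
  shows "F (gmean z z') i j = sqrt (F z i j * F z' i j)"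
    and "U (gmean z z') i j = sqrt (U z i j * U z' i j)"
    and "V (gmean z z') i j = sqrt (V z i j * V z' i j)"
proof -
  have *: "rpow (fst (gmean z z') i) b = sqrt (rpow (fst z i) b * rpow (fst z' i) b)"
    "rpow (snd (gmean z z') j) b = sqrt (rpow (snd z j) b * rpow (snd z' j) b)" for b
    using K_nonneg[OF assms(1)] K_nonneg[OF assms(2)] by (simp_all add: gmean_def rpow_sqrt)
  have a: "0 \<le> a i j" "0 \<le> \<alpha> * a i j" "0 \<le> \<beta> * a i j" using a_nonneg[OF assms(3,4)] \<alpha> \<beta> by auto
  show "F (gmean z z') i j = sqrt (F z i j * F z' i j)"
    unfolding F_eq * by (rule sqrt_mult_monomials[OF a(1)])
  show "U (gmean z z') i j = sqrt (U z i j * U z' i j)"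
    unfolding U_eq * by (rule sqrt_mult_monomials[OF a(2)])
  show "V (gmean z z') i j = sqrt (V z i j * V z' i j)"
    unfolding V_eq * by (rule sqrt_mult_monomials[OF a(3)])
qed

lemma d_eq: "d z z' = L2_set (\<lambda>x. case_prod (F z) x - case_prod (F z') x) ({..<m} \<times> {..<n})"
  by (simp add: d_dist_def frob_norm_def case_prod_unfold)

lemma d_nonneg: "0 \<le> d z z'"
  unfolding d_eq by simp

lemma d_self: "d z z = 0"
  unfolding d_eq by (simp add: L2_set_def)

lemma d_sym: "d z z' = d z' z"
  unfolding d_eq by (rule L2_diff_sym)

lemma d_tri: "d x z \<le> d x y + d y z"
  unfolding d_eq by (rule L2_diff_tri)

lemma d_gmean:
  assumes "z \<in> K" "z' \<in> K"
  shows "d z (gmean z z') \<le> d z z'"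
  unfolding d_eq
  by (rule L2_mono_abs) (use assms in \<open>auto simp: maps_gmean intro!: abs_diff_sqrt_le maps_nonneg\<close>)

definition \<rho>U :: "rvec \<times> rvec \<Rightarrow> rvec \<times> rvec \<Rightarrow> real" where
  "\<rho>U z z' = (MAX i\<in>{..<m}. L2_set (\<lambda>j. U z i j - U z' i j) {..<n})"

definition \<rho>V :: "rvec \<times> rvec \<Rightarrow> rvec \<times> rvec \<Rightarrow> real" where
  "\<rho>V z z' = (MAX j\<in>{..<n}. L2_set (\<lambda>i. V z i j - V z' i j) {..<m})"

lemma \<rho>_eq: "\<rho> z z' = \<rho>U z z' + \<rho>V z z'"
  by (simp add: rho_dist_def \<rho>U_def \<rho>V_def)

lemma \<rho>U_ge: "i < m \<Longrightarrow> L2_set (\<lambda>j. U z i j - U z' i j) {..<n} \<le> \<rho>U z z'"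
  unfolding \<rho>U_def by (intro Max_ge) auto

lemma \<rho>V_ge: "j < n \<Longrightarrow> L2_set (\<lambda>i. V z i j - V z' i j) {..<m} \<le> \<rho>V z z'"
  unfolding \<rho>V_def by (intro Max_ge) auto

lemma \<rho>U_le:
  assumes "\<And>i. i < m \<Longrightarrow> L2_set (\<lambda>j. U z i j - U z' i j) {..<n} \<le> b"
  shows "\<rho>U z z' \<le> b"
  unfolding \<rho>U_def using assms m_pos by (intro Max.boundedI) auto

lemma \<rho>V_le:
  assumes "\<And>j. j < n \<Longrightarrow> L2_set (\<lambda>i. V z i j - V z' i j) {..<m} \<le> b"
  shows "\<rho>V z z' \<le> b"
  unfolding \<rho>V_def using assms n_pos by (intro Max.boundedI) auto

lemma \<rho>U_nonneg: "0 \<le> \<rho>U z z'"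
  using order_trans[OF L2_set_nonneg \<rho>U_ge[OF m_pos]] .

lemma \<rho>V_nonneg: "0 \<le> \<rho>V z z'"
  using order_trans[OF L2_set_nonneg \<rho>V_ge[OF n_pos]] .

lemma \<rho>_nonneg: "0 \<le> \<rho> z z'"
  by (simp add: \<rho>_eq \<rho>U_nonneg \<rho>V_nonneg)

lemma \<rho>_sym: "\<rho> z z' = \<rho> z' z"
  unfolding \<rho>_eq \<rho>U_def \<rho>V_def
  by (simp only: L2_diff_sym[of "U z _"] L2_diff_sym[of "\<lambda>i. V z i _"])

lemma \<rho>_tri: "\<rho> x z \<le> \<rho> x y + \<rho> y z"
proof -
  have "\<rho>U x z \<le> \<rho>U x y + \<rho>U y z"
  proof (rule \<rho>U_le)
    fix i assume "i < m"
    from add_mono[OF \<rho>U_ge[OF this] \<rho>U_ge[OF this]]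
    show "L2_set (\<lambda>j. U x i j - U z i j) {..<n} \<le> \<rho>U x y + \<rho>U y z"
      by (rule order_trans[OF L2_diff_tri])
  qed
  moreover have "\<rho>V x z \<le> \<rho>V x y + \<rho>V y z"
  proof (rule \<rho>V_le)
    fix j assume "j < n"
    from add_mono[OF \<rho>V_ge[OF this] \<rho>V_ge[OF this]]
    show "L2_set (\<lambda>i. V x i j - V z i j) {..<m} \<le> \<rho>V x y + \<rho>V y z"
      by (rule order_trans[OF L2_diff_tri])
  qed
  ultimately show ?thesis by (simp add: \<rho>_eq)
qed

lemma \<rho>_gmean:
  assumes "z \<in> K" "z' \<in> K"
  shows "\<rho> z (gmean z z') \<le> \<rho> z z'"
proof -
  have "\<rho>U z (gmean z z') \<le> \<rho>U z z'"
  proof (rule \<rho>U_le)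
    fix i assume i: "i < m"
    have "L2_set (\<lambda>j. U z i j - U (gmean z z') i j) {..<n} \<le> L2_set (\<lambda>j. U z i j - U z' i j) {..<n}"
      using assms i by (intro L2_mono_abs) (auto simp: maps_gmean intro!: abs_diff_sqrt_le maps_nonneg)
    then show "L2_set (\<lambda>j. U z i j - U (gmean z z') i j) {..<n} \<le> \<rho>U z z'"
      by (rule order_trans[OF _ \<rho>U_ge[OF i]])
  qed
  moreover have "\<rho>V z (gmean z z') \<le> \<rho>V z z'"
  proof (rule \<rho>V_le)
    fix j assume j: "j < n"
    have "L2_set (\<lambda>i. V z i j - V (gmean z z') i j) {..<m} \<le> L2_set (\<lambda>i. V z i j - V z' i j) {..<m}"
      using assms j by (intro L2_mono_abs) (auto simp: maps_gmean intro!: abs_diff_sqrt_le maps_nonneg)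
    then show "L2_set (\<lambda>i. V z i j - V (gmean z z') i j) {..<m} \<le> \<rho>V z z'"
      by (rule order_trans[OF _ \<rho>V_ge[OF j]])
  qed
  ultimately show ?thesis by (simp add: \<rho>_eq)
qed

lemma wt_le:
  assumes "i \<in> I"
  shows "wt z i \<le> wt z' i + \<rho> z z'"
proof -
  consider k where "i = Inl k" "k < m" | k where "i = Inr k" "k < n" using assms by auto
  then show ?thesis
  proof cases
    case 1
    have "wt z i \<le> wt z' i + L2_set (\<lambda>j. U z k j - U z' k j) {..<n}"
      using L2_le_diff[of "U z k" "{..<n}" "U z' k"] by (simp add: wt_def 1)
    then show ?thesis using \<rho>U_ge[OF 1(2), of z z'] \<rho>V_nonneg[of z z'] by (simp add: \<rho>_eq)
  next
    case 2
    have "wt z i \<le> wt z' i + L2_set (\<lambda>l. V z l k - V z' l k) {..<m}"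
      using L2_le_diff[of "\<lambda>l. V z l k" "{..<m}" "\<lambda>l. V z' l k"] by (simp add: wt_def 2)
    then show ?thesis using \<rho>V_ge[OF 2(2), of z z'] \<rho>U_nonneg[of z z'] by (simp add: \<rho>_eq)
  qed
qed

lemma L2_Inl_le: "L2_set (\<lambda>i. f (Inl i)) {..<m} \<le> L2_set f I"
  unfolding L2_set_def sum_I by (intro real_sqrt_le_mono) (simp add: sum_nonneg)

lemma L2_Inr_le: "L2_set (\<lambda>j. f (Inr j)) {..<n} \<le> L2_set f I"
  unfolding L2_set_def sum_I by (intro real_sqrt_le_mono) (simp add: sum_nonneg)

text \<open>
  The maxima over both endpoints are replaced by the value at \<open>z\<close> plus the difference, which is what \<open>\<rho>\<close>
  measures.
\<close>

lemma F_increment: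
  assumes z: "z \<in> K" "z' \<in> K" and ij: "i < m" "j < n"
  defines "h \<equiv> fst z i - fst z' i" and "k \<equiv> snd z j - snd z' j"
  shows "\<bar>F z i j - F z' i j\<bar>
    \<le> \<bar>U z i j * h\<bar> + \<bar>(U z i j - U z' i j) * h\<bar> + (\<bar>V z i j * k\<bar> + \<bar>(V z i j - V z' i j) * k\<bar>)"
proof -
  define A B where "A z = \<alpha> * rpow (fst z i) (\<alpha> - 1) * rpow (snd z j) \<beta>"
    and "B z = \<beta> * rpow (fst z i) \<alpha> * rpow (snd z j) (\<beta> - 1)" for z :: "rvec \<times> rvec"
  have a: "0 \<le> a i j" by (rule a_nonneg[OF ij])
  have AU: "a i j * A w = U w i j" and BV: "a i j * B w = V w i j" for w
    by (simp_all add: A_def B_def U_eq V_eq algebra_simps)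
  have "F z i j - F z' i j = a i j * (rpow (fst z i) \<alpha> * rpow (snd z j) \<beta> - rpow (fst z' i) \<alpha> * rpow (snd z' j) \<beta>)"
    by (simp add: F_eq algebra_simps)
  then have "\<bar>F z i j - F z' i j\<bar>
      = a i j * \<bar>rpow (fst z i) \<alpha> * rpow (snd z j) \<beta> - rpow (fst z' i) \<alpha> * rpow (snd z' j) \<beta>\<bar>"
    using a by (simp add: abs_mult)
  also have "\<dots> \<le> a i j * (max (A z) (A z') * \<bar>h\<bar> + max (B z) (B z') * \<bar>k\<bar>)"
    unfolding A_def B_def h_def k_def
    by (intro mult_left_mono a monomial_increment K_nonneg z \<alpha> \<beta>)
  also have "\<dots> = max (U z i j) (U z' i j) * \<bar>h\<bar> + max (V z i j) (V z' i j) * \<bar>k\<bar>"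
  proof -
    have "a i j * max x y = max (a i j * x) (a i j * y)" for x y
      using a by (simp add: max_mult_distrib_left)
    then show ?thesis by (simp only: distrib_left AU BV flip: mult.assoc)
  qed
  also have "\<dots> \<le> (\<bar>U z i j\<bar> + \<bar>U z i j - U z' i j\<bar>) * \<bar>h\<bar> + (\<bar>V z i j\<bar> + \<bar>V z i j - V z' i j\<bar>) * \<bar>k\<bar>"
    by (intro add_mono mult_right_mono) auto
  finally show ?thesis by (simp add: abs_mult distrib_right)
qed

text \<open>
  The four terms of the entrywise bound act diagonally, either on the rows or on the columns, so their
  Frobenius norms reduce to weighted Euclidean norms of \<open>z - z'\<close>.
\<close>

lemma d_le:
  assumes z: "z \<in> K" "z' \<in> K"
  shows "d z z' \<le> 2 * L2_set (\<lambda>i. wt z i * (coord z i - coord z' i)) I + \<rho> z z' * eucl z z'"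
proof -
  define h k where "h i = fst z i - fst z' i" and "k i = snd z i - snd z' i" for i
  let ?P = "{..<m} \<times> {..<n}"
  define f1 f2 f3 f4 where "f1 = (\<lambda>(i, j). U z i j * h i)" and "f2 = (\<lambda>(i, j). (U z i j - U z' i j) * h i)"
    and "f3 = (\<lambda>(i, j). V z i j * k j)" and "f4 = (\<lambda>(i, j). (V z i j - V z' i j) * k j)"
  have "d z z' \<le> L2_set (\<lambda>x. \<bar>f1 x\<bar> + \<bar>f2 x\<bar> + (\<bar>f3 x\<bar> + \<bar>f4 x\<bar>)) ?P"
    unfolding d_eq
  proof (rule L2_mono_abs)
    fix x assume x: "x \<in> ?P"
    have "\<bar>F z (fst x) (snd x) - F z' (fst x) (snd x)\<bar> \<le> \<bar>f1 x\<bar> + \<bar>f2 x\<bar> + (\<bar>f3 x\<bar> + \<bar>f4 x\<bar>)"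
      using F_increment[OF z, of "fst x" "snd x"] x
      by (auto simp: f1_def f2_def f3_def f4_def h_def k_def)
    then show "\<bar>case_prod (F z) x - case_prod (F z') x\<bar> \<le> \<bar>\<bar>f1 x\<bar> + \<bar>f2 x\<bar> + (\<bar>f3 x\<bar> + \<bar>f4 x\<bar>)\<bar>"
      by (simp add: case_prod_unfold)
  qed
  also have "\<dots> \<le> L2_set (\<lambda>x. \<bar>f1 x\<bar> + \<bar>f2 x\<bar>) ?P + L2_set (\<lambda>x. \<bar>f3 x\<bar> + \<bar>f4 x\<bar>) ?P"
    by (rule L2_set_triangle_ineq)
  also have "\<dots> \<le> (L2_set (\<lambda>x. \<bar>f1 x\<bar>) ?P + L2_set (\<lambda>x. \<bar>f2 x\<bar>) ?P)
      + (L2_set (\<lambda>x. \<bar>f3 x\<bar>) ?P + L2_set (\<lambda>x. \<bar>f4 x\<bar>) ?P)"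
    by (intro add_mono L2_set_triangle_ineq)
  also have "\<dots> = (L2_set f1 ?P + L2_set f2 ?P) + (L2_set f3 ?P + L2_set f4 ?P)"
    by (simp add: L2_set_def)
  also have "\<dots> \<le> (L2_set (\<lambda>i. wt z i * (coord z i - coord z' i)) I + \<rho>U z z' * eucl z z')
      + (L2_set (\<lambda>i. wt z i * (coord z i - coord z' i)) I + \<rho>V z z' * eucl z z')"
  proof (intro add_mono)
    let ?w = "\<lambda>i. wt z i * (coord z i - coord z' i)"
    have "L2_set f1 ?P = L2_set (\<lambda>i. ?w (Inl i)) {..<m}"
      unfolding f1_def by (subst L2_rows) (simp_all add: wt_def coord_def h_def)
    then show "L2_set f1 ?P \<le> L2_set ?w I" using L2_Inl_le[of ?w] by simp
    have "L2_set f3 ?P = L2_set (\<lambda>i. ?w (Inr i)) {..<n}"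
      unfolding f3_def by (subst L2_columns) (simp_all add: wt_def coord_def k_def)
    then show "L2_set f3 ?P \<le> L2_set ?w I" using L2_Inr_le[of ?w] by simp
    have "L2_set f2 ?P = L2_set (\<lambda>i. L2_set (\<lambda>j. U z i j - U z' i j) {..<n} * h i) {..<m}"
      unfolding f2_def by (rule L2_rows) auto
    also have "\<dots> \<le> \<rho>U z z' * L2_set h {..<m}"
      using \<rho>U_ge by (intro L2_scale_le \<rho>U_nonneg) auto
    also have "L2_set h {..<m} \<le> eucl z z'"
      using L2_Inl_le[of "\<lambda>i. coord z i - coord z' i"] by (simp add: eucl_def coord_def h_def[abs_def])
    finally show "L2_set f2 ?P \<le> \<rho>U z z' * eucl z z'" by (simp add: mult_left_mono \<rho>U_nonneg)
    have "L2_set f4 ?P = L2_set (\<lambda>j. L2_set (\<lambda>i. V z i j - V z' i j) {..<m} * k j) {..<n}"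
      unfolding f4_def by (rule L2_columns) auto
    also have "\<dots> \<le> \<rho>V z z' * L2_set k {..<n}"
      using \<rho>V_ge by (intro L2_scale_le \<rho>V_nonneg) auto
    also have "L2_set k {..<n} \<le> eucl z z'"
      using L2_Inr_le[of "\<lambda>i. coord z i - coord z' i"] by (simp add: eucl_def coord_def k_def[abs_def])
    finally show "L2_set f4 ?P \<le> \<rho>V z z' * eucl z z'" by (simp add: mult_left_mono \<rho>V_nonneg)
  qed
  finally show ?thesis by (simp add: \<rho>_eq distrib_right)
qed

lemma sum_unit_vec:
  assumes "l < k"
  shows "(\<Sum>i<k. (c i * unit_vec l i)\<^sup>2) = (c l)\<^sup>2"
proof -
  have "(\<Sum>i<k. (c i * unit_vec l i)\<^sup>2) = (\<Sum>i<k. if i = l then (c i)\<^sup>2 else 0)"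
    by (intro sum.cong) (auto simp: unit_vec_def)
  also have "\<dots> = (c l)\<^sup>2" using assms by (simp add: sum.delta)
  finally show ?thesis .
qed

text \<open>
  The image of the basis vector \<open>e\<^sub>i\<close> of the first factor is the \<open>i\<close>-th row of \<open>U\<close>, and the image of \<open>e\<^sub>j\<close>
  of the second factor is the \<open>j\<close>-th column of \<open>V\<close>.
\<close>

lemma hs_norm_eq: "hs_norm m n (T_map \<alpha> \<beta> a z) = L2_set (wt z) I"
proof -
  have "(frob_norm m n (T_map \<alpha> \<beta> a z (unit_vec l, \<lambda>_. 0)))\<^sup>2 = (wt z (Inl l))\<^sup>2" if "l < m" for l
  proof -
    have "frob_norm m n (T_map \<alpha> \<beta> a z (unit_vec l, \<lambda>_. 0))
      = L2_set (\<lambda>i. L2_set (U z i) {..<n} * unit_vec l i) {..<m}"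
      unfolding frob_norm_def T_map_def by (subst L2_rows[symmetric]) simp_all
    then show ?thesis using sum_unit_vec[OF that] by (simp add: L2_set_def wt_def sum_nonneg)
  qed
  moreover have "(frob_norm m n (T_map \<alpha> \<beta> a z (\<lambda>_. 0, unit_vec l)))\<^sup>2 = (wt z (Inr l))\<^sup>2" if "l < n" for l
  proof -
    have "frob_norm m n (T_map \<alpha> \<beta> a z (\<lambda>_. 0, unit_vec l))
      = L2_set (\<lambda>j. L2_set (\<lambda>i. V z i j) {..<m} * unit_vec l j) {..<n}"
      unfolding frob_norm_def T_map_def by (subst L2_columns[symmetric]) simp_all
    then show ?thesis using sum_unit_vec[OF that] by (simp add: L2_set_def wt_def sum_nonneg)
  qed
  ultimately show ?thesis unfolding hs_norm_def L2_set_def[of "wt z"] sum_I by simp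
qed

text \<open>
  Each \<open>\<phi>\<^sub>k\<close> is the regularised sum of the distance to the net of level \<open>k\<close> and the entropy number of the
  ellipsoid with semiaxes \<open>wt\<close>. On a set with \<open>\<rho> \<le> 2 \<theta>\<close> the ellipsoid of a single point serves all
  others, since the semiaxes differ by at most \<open>2 \<theta>\<close>. The scale of \<open>\<phi>\<close> is \<open>10 M\<close> and the \<open>d\<close>-diameter of
  \<open>K\<close> is at most \<open>8 M\<close>, which yields the constant \<open>2\<^sup>4 (6 * 8 + 6 * 25000 * 10)\<close>.
\<close>

theorem gamma2_le:
  assumes R: "\<And>z. z \<in> K \<Longrightarrow> hs_norm m n (T_map \<alpha> \<beta> a z) \<le> M"
    and P: "gamma22 K \<rho> < ennreal M" and M: "0 < M"
  shows "gamma2 K d \<le> ennreal (24000768 * M)"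
proof -
  have ne: "K \<noteq> {}"
  proof -
    have "((\<lambda>_. 0), (\<lambda>_. 0)) \<in> K" by (simp add: K_set_def pos_ball_def L2_set_def)
    then show ?thesis by auto
  qed
  obtain c where c: "\<And>k x. x \<in> K \<Longrightarrow> c k x \<in> K"
    "\<And>k. finite (c k ` K) \<and> card (c k ` K) \<le> 2 ^ 2 ^ k"
    "\<And>x y. x \<in> K \<Longrightarrow> y \<in> K \<Longrightarrow> c 0 x = c 0 y"
    "\<And>x n. x \<in> K \<Longrightarrow> (\<Sum>k<n. 2 ^ k * (\<rho> x (c k x))\<^sup>2) \<le> M\<^sup>2"
    by (rule gamma22_nets[OF P ne \<rho>_nonneg]) (rule that)
  define net where "net k = c k ` K" for k
  have net: "finite (net k)" "net k \<noteq> {}" "card (net k) \<le> 2 ^ 2 ^ k" for k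
    using c(2) ne by (auto simp: net_def)
  define dn where "dn k y = Min ((\<lambda>x. \<rho> y x) ` net k)" for k y
  have dn_le: "dn k y \<le> \<rho> y x" if "x \<in> net k" for k x y
    unfolding dn_def using net that by (intro Min_le) auto
  have dn_at: "\<exists>x\<in>net k. dn k y = \<rho> y x" for k y
  proof -
    have "dn k y \<in> (\<lambda>x. \<rho> y x) ` net k" unfolding dn_def using net by (intro Min_in) auto
    then show ?thesis by auto
  qed
  have dn_nonneg: "0 \<le> dn k y" for k y using dn_at[of k y] \<rho>_nonneg by metis
  have dn_lip: "dn k x \<le> dn k y + \<rho> y x" for k x y
  proof -
    obtain v where "v \<in> net k" "dn k y = \<rho> y v" using dn_at by blast
    then show ?thesis using dn_le[of v k x] \<rho>_tri[of x v y] \<rho>_sym[of x y] by linarith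
  qed
  define en where "en k y = ell_num I (wt y) (2 ^ k)" for k y
  have en_nonneg: "0 \<le> en k y" for k y unfolding en_def by (rule ell_num_nonneg[OF finite_I])
  have en_lip: "en k x \<le> en k y + \<rho> y x" for k x y
    unfolding en_def using wt_le[of _ x y] \<rho>_nonneg[of y x] \<rho>_sym[of x y]
    by (intro ell_num_lipschitz finite_I) auto
  define \<phi> where "\<phi> k y = regularize (\<lambda>k. dn k y + en k y) k" for k y
  have f0: "0 \<le> dn k y + en k y" for k y using dn_nonneg en_nonneg by (simp add: add_nonneg_nonneg)
  have \<phi>_ge: "dn k y + en k y \<le> \<phi> k y" for k y unfolding \<phi>_def by (rule regularize_ge)
  have \<phi>_sum: "(\<Sum>k<l. 2 ^ k * (\<phi> k x)\<^sup>2) \<le> (10 * M)\<^sup>2" if x: "x \<in> K" for l x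
  proof -
    have "(\<Sum>k<l. 2 ^ k * (dn k x + en k x)\<^sup>2)
        \<le> (\<Sum>k<l. 2 * (2 ^ k * (\<rho> x (c k x))\<^sup>2) + 2 * (2 ^ k * (en k x)\<^sup>2))"
    proof (rule sum_mono)
      fix k
      have "dn k x \<le> \<rho> x (c k x)" using x by (intro dn_le) (simp add: net_def)
      then have "(dn k x + en k x)\<^sup>2 \<le> (\<rho> x (c k x) + en k x)\<^sup>2"
        using f0 by (intro power_mono) auto
      also have "\<dots> \<le> 2 * (\<rho> x (c k x))\<^sup>2 + 2 * (en k x)\<^sup>2"
        using zero_le_power2[of "\<rho> x (c k x) - en k x"] by (simp add: power2_eq_square algebra_simps)
      finally have "2 ^ k * (dn k x + en k x)\<^sup>2 \<le> 2 ^ k * (2 * (\<rho> x (c k x))\<^sup>2 + 2 * (en k x)\<^sup>2)"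
        by (intro mult_left_mono) auto
      then show "2 ^ k * (dn k x + en k x)\<^sup>2 \<le> 2 * (2 ^ k * (\<rho> x (c k x))\<^sup>2) + 2 * (2 ^ k * (en k x)\<^sup>2)"
        by (simp add: algebra_simps)
    qed
    also have "\<dots> = 2 * (\<Sum>k<l. 2 ^ k * (\<rho> x (c k x))\<^sup>2) + 2 * (\<Sum>k<l. 2 ^ k * (en k x)\<^sup>2)"
      by (simp add: sum.distrib sum_distrib_left)
    also have "(\<Sum>k<l. 2 ^ k * (en k x)\<^sup>2) \<le> 4 * (\<Sum>i\<in>I. (wt x i)\<^sup>2)"
      unfolding en_def by (rule sum_ell_num[OF finite_I wt_nonneg])
    also have "(\<Sum>i\<in>I. (wt x i)\<^sup>2) \<le> M\<^sup>2"
    proof -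
      have "sqrt (\<Sum>i\<in>I. (wt x i)\<^sup>2) \<le> M" using R[OF x] unfolding hs_norm_eq L2_set_def .
      then show ?thesis by (rule sqrt_le_D)
    qed
    also have "(\<Sum>k<l. 2 ^ k * (\<rho> x (c k x))\<^sup>2) \<le> M\<^sup>2" by (rule c(4)[OF x])
    finally have "(\<Sum>k<l. 2 ^ k * (dn k x + en k x)\<^sup>2) \<le> 10 * M\<^sup>2" by simp
    moreover have "(\<Sum>k<l. 2 ^ k * (\<phi> k x)\<^sup>2) \<le> 9 * (\<Sum>k<l. 2 ^ k * (dn k x + en k x)\<^sup>2)"
      unfolding \<phi>_def by (rule sum_regularize[OF f0])
    ultimately have "(\<Sum>k<l. 2 ^ k * (\<phi> k x)\<^sup>2) \<le> 90 * M\<^sup>2" by linarith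
    also have "\<dots> \<le> (10 * M)\<^sup>2" by (simp add: power_mult_distrib)
    finally show ?thesis .
  qed
  interpret interp: interpolation K d \<rho> eucl qform gmean \<phi> "10 * M"
  proof
    show "0 < 10 * M" using M by simp
    show "\<phi> k x \<le> 3 / 2 * \<phi> (Suc k) x" for k x
      unfolding \<phi>_def by (rule regularize_step)
    show "0 \<le> \<phi> k x" for k x using f0[of k x] \<phi>_ge[of k x] by linarith
    show "\<phi> k (gmean x y) \<le> \<phi> k x + 2 * \<rho> x y" if "x \<in> K" "y \<in> K" for k x y
      unfolding \<phi>_def
    proof (rule regularize_lipschitz)
      show "0 \<le> 2 * \<rho> x y" using \<rho>_nonneg by simp
      fix k
      show "dn k (gmean x y) + en k (gmean x y) \<le> dn k x + en k x + 2 * \<rho> x y"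
        using dn_lip[of k "gmean x y" x] en_lip[of k "gmean x y" x] \<rho>_gmean[OF that] by linarith
    qed
    show "splits K (2 ^ 2 ^ k) (\<lambda>x y. \<rho> x y \<le> \<phi> k x + \<phi> k y)" for k
    proof -
      obtain v where v: "\<And>y. v y \<in> net k" "\<And>y. dn k y = \<rho> y (v y)" using dn_at[of k] by metis
      show ?thesis
      proof (rule splits_by_code[where V = "net k" and c = v])
        fix x y assume "v x = v y"
        then have "\<rho> x y \<le> dn k x + dn k y"
          using \<rho>_tri[of x y "v x"] \<rho>_sym[of y "v x"] v(2)[of x] v(2)[of y] by simp
        then show "\<rho> x y \<le> \<phi> k x + \<phi> k y"
          using \<phi>_ge[of k x] \<phi>_ge[of k y] en_nonneg[of k x] en_nonneg[of k y] by linarith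
      qed (use net v in auto)
    qed
    show "splits S (2 ^ (5 * 2 ^ k)) (\<lambda>x y. d x y \<le> 12 * \<theta> * X)"
      if S: "S \<subseteq> K" and S\<phi>: "\<And>x. x \<in> S \<Longrightarrow> \<phi> k x \<le> \<theta>"
        and S\<rho>: "\<And>x y. x \<in> S \<Longrightarrow> y \<in> S \<Longrightarrow> \<rho> x y \<le> 2 * \<theta>"
        and Se: "\<And>x y. x \<in> S \<Longrightarrow> y \<in> S \<Longrightarrow> eucl x y \<le> X" for k S \<theta> X
    proof (cases "S = {}")
      case True
      then show ?thesis by (simp add: splits_def)
    next
      case False
      then obtain y0 where y0: "y0 \<in> S" by auto
      have \<theta>: "ell_num I (wt y0) (2 ^ k) \<le> \<theta>"
        using S\<phi>[OF y0] \<phi>_ge[of k y0] dn_nonneg[of k y0] unfolding en_def by linarith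
      have \<theta>0: "0 \<le> \<theta>" using S\<rho>[OF y0 y0] \<rho>_nonneg[of y0 y0] by linarith
      have "splits S (2 ^ (5 * 2 ^ k))
        (\<lambda>y y'. L2_set (\<lambda>i. wt y0 i * (coord y i - coord y' i)) I \<le> 3 * \<theta> * X)"
        by (rule splits_ellipsoid[OF finite_I wt_nonneg \<theta>]) (use Se in \<open>simp add: eucl_def\<close>)
      then show ?thesis
      proof (rule splits_mono)
        fix x y assume xy: "x \<in> S" "y \<in> S"
          and L: "L2_set (\<lambda>i. wt y0 i * (coord x i - coord y i)) I \<le> 3 * \<theta> * X"
        have "L2_set (\<lambda>i. wt x i * (coord x i - coord y i)) I
            \<le> L2_set (\<lambda>i. wt y0 i * (coord x i - coord y i)) I
              + L2_set (\<lambda>i. (wt x i - wt y0 i) * (coord x i - coord y i)) I"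
          using L2_le_diff[of "\<lambda>i. wt x i * (coord x i - coord y i)" I "\<lambda>i. wt y0 i * (coord x i - coord y i)"]
          by (simp add: left_diff_distrib)
        also have "L2_set (\<lambda>i. (wt x i - wt y0 i) * (coord x i - coord y i)) I \<le> 2 * \<theta> * eucl x y"
          unfolding eucl_def
        proof (rule L2_scale_le)
          fix i assume i: "i \<in> I"
          show "\<bar>wt x i - wt y0 i\<bar> \<le> 2 * \<theta>"
            using wt_le[OF i, of x y0] wt_le[OF i, of y0 x] S\<rho>[OF xy(1) y0] S\<rho>[OF y0 xy(1)] by linarith
        qed (use \<theta>0 in simp)
        finally have w: "L2_set (\<lambda>i. wt x i * (coord x i - coord y i)) I \<le> 3 * \<theta> * X + 2 * \<theta> * eucl x y"
          using L by linarith
        have "\<theta> * eucl x y \<le> \<theta> * X" using Se[OF xy] \<theta>0 by (intro mult_left_mono)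
        moreover have "\<rho> x y * eucl x y \<le> 2 * \<theta> * eucl x y"
          using S\<rho>[OF xy] eucl_nonneg by (intro mult_right_mono)
        moreover have "d x y \<le> 2 * L2_set (\<lambda>i. wt x i * (coord x i - coord y i)) I + \<rho> x y * eucl x y"
          using xy S by (intro d_le) auto
        ultimately show "d x y \<le> 12 * \<theta> * X"
          using w by (simp add: mult.assoc)
      qed simp
    qed
  qed (assumption | rule d_nonneg d_self d_sym d_tri qform_bounds gmean_in gmean_sym
      d_gmean qform_gmean \<rho>_sym \<phi>_sum)+
  have "d x y \<le> 8 * M" if xy: "x \<in> K" "y \<in> K" for x y
  proof -
    have "\<rho> x (c 0 x) \<le> M" "\<rho> y (c 0 y) \<le> M"
      using c(4)[OF xy(1), of 1] c(4)[OF xy(2), of 1] M by (auto intro: power2_le_imp_le)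
    then have r: "\<rho> x y \<le> 2 * M"
      using \<rho>_tri[of x y "c 0 x"] \<rho>_sym[of "c 0 x" y] c(3)[OF xy] by simp
    have "\<bar>wt x i\<bar> \<le> M" if "i \<in> I" for i
    proof -
      have "wt x i \<le> L2_set (wt x) I" using that wt_nonneg by (intro member_le_L2_set) auto
      then show ?thesis using R[OF xy(1)] wt_nonneg[of x i] by (simp add: hs_norm_eq)
    qed
    then have "L2_set (\<lambda>i. wt x i * (coord x i - coord y i)) I \<le> M * eucl x y"
      unfolding eucl_def using M by (intro L2_scale_le) auto
    also have "\<dots> \<le> M * 2" using eucl_le[OF xy] M by (intro mult_left_mono) auto
    finally have w: "L2_set (\<lambda>i. wt x i * (coord x i - coord y i)) I \<le> M * 2" .
    have "\<rho> x y * eucl x y \<le> (2 * M) * 2"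
      using r eucl_le[OF xy] M eucl_nonneg by (intro mult_mono) auto
    then show ?thesis using d_le[OF xy] w by linarith
  qed
  from interp.gamma2_le[OF ne this] show ?thesis by simp
qed

end

lemma expo_ge_one:
  assumes "2 \<le> p"
  shows "1 \<le> expo p"
proof (cases p)
  case (real r)
  then have "2 - 2 / p = ereal (2 - 2 / r)" using assms by simp
  then show ?thesis using assms real by (simp add: expo_def field_simps)
qed (use assms in \<open>auto simp: expo_def\<close>)

theorem proposition6p1:
  shows "\<exists>C::real. C > 0 \<and>
    (\<forall>(r::ereal) (s::ereal) (m::nat) (n::nat) (a::nat \<Rightarrow> nat \<Rightarrow> real).
       2 \<le> r \<and> 2 \<le> s \<and> 0 < m \<and> 0 < n \<and> (\<forall>i<m. \<forall>j<n. 0 \<le> a i j) \<longrightarrow>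
       (let \<alpha> = expo s; \<beta> = expo r; K = K_set m n;
            R = (SUP z\<in>K. ennreal (hs_norm m n (T_map \<alpha> \<beta> a z)));
            P = gamma22 K (rho_dist m n \<alpha> \<beta> a)
        in gamma2 K (d_dist m n \<alpha> \<beta> a) \<le> ennreal C * (R + P)))"
proof (intro exI[of _ 24000768] conjI allI impI)
  fix r s :: ereal and m n :: nat and a :: "nat \<Rightarrow> nat \<Rightarrow> real"
  assume asm: "2 \<le> r \<and> 2 \<le> s \<and> 0 < m \<and> 0 < n \<and> (\<forall>i<m. \<forall>j<n. 0 \<le> a i j)"
  define \<alpha> \<beta> where "\<alpha> = expo s" and "\<beta> = expo r"
  define R P where "R = (SUP z\<in>K_set m n. ennreal (hs_norm m n (T_map \<alpha> \<beta> a z)))"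
    and "P = gamma22 (K_set m n) (rho_dist m n \<alpha> \<beta> a)"
  interpret monomial_map m n \<alpha> \<beta> a
    by standard (use asm expo_ge_one in \<open>auto simp: \<alpha>_def \<beta>_def\<close>)
  have "gamma2 K d \<le> ennreal 24000768 * (R + P)"
  proof (cases "R + P = \<infinity>")
    case True
    show ?thesis unfolding True by (simp add: ennreal_mult_top)
  next
    case False
    then obtain R' P' where RP: "R = ennreal R'" "0 \<le> R'" "P = ennreal P'" "0 \<le> P'"
      by (cases R; cases P) auto
    show ?thesis
    proof (rule ennreal_le_epsilon)
      (* The room e gives a positive scale even if R = P = 0, and an admissible sequence
         that beats the scale even if the infimum P is not attained. *)
      fix e :: real assume e: "0 < e"
      define M where "M = R' + P' + e / 24000768"
      have "gamma2 K d \<le> ennreal (24000768 * M)"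
      proof (rule gamma2_le)
        show "0 < M" using e RP by (simp add: M_def add_nonneg_pos)
        have "P' < M" using e RP by (simp add: M_def add_nonneg_pos)
        then have "ennreal P' < ennreal M" using RP(4) by (simp add: ennreal_less_iff)
        then show "gamma22 K \<rho> < ennreal M" using RP(3) by (simp add: P_def)
        fix z assume "z \<in> K"
        then have "ennreal (hs_norm m n (T_map \<alpha> \<beta> a z)) \<le> ennreal R'"
          unfolding RP(1)[symmetric] R_def by (rule SUP_upper)
        then show "hs_norm m n (T_map \<alpha> \<beta> a z) \<le> M" using e RP by (simp add: M_def)
      qed
      also have "24000768 * M = 24000768 * (R' + P') + e" by (simp add: M_def)
      also have "ennreal (24000768 * (R' + P') + e) = ennreal 24000768 * (R + P) + ennreal e"
      proof -
        have "R + P = ennreal (R' + P')" using RP by simp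
        moreover have "ennreal 24000768 * ennreal (R' + P') = ennreal (24000768 * (R' + P'))"
          using RP by (intro ennreal_mult[symmetric]) auto
        ultimately show ?thesis using RP e by (simp only:) (intro ennreal_plus, auto)
      qed
      finally show "gamma2 K d \<le> ennreal 24000768 * (R + P) + ennreal e" .
    qed
  qed
  then show "let \<alpha> = expo s; \<beta> = expo r; K = K_set m n;
            R = (SUP z\<in>K. ennreal (hs_norm m n (T_map \<alpha> \<beta> a z)));
            P = gamma22 K (rho_dist m n \<alpha> \<beta> a)
        in gamma2 K (d_dist m n \<alpha> \<beta> a) \<le> ennreal 24000768 * (R + P)"
    unfolding Let_def R_def P_def \<alpha>_def \<beta>_def .
qed simp

end
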